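(* Let $A$ be a uniform algebra on a compact space $X$ and $\sigma$ a probability measure on $X$. Let $1\le p\le 2$, $1\le s<p$, and let $q$ be defined by $\frac1s=\frac1p+\frac1q$; let $p',s',q'$ be the conjugate exponents of $p,s,q$. Let $S\subset\mathcal{M}_s\cap\mathcal{M}_{q'}$ be a sequence such that $S$ is dual bounded in $H^p(\sigma)$ and $S$ is weakly $q$-Carleson. Suppose that $\sigma$ satisfies the structural hypotheses: $SH(q)$: there is $\alpha>0$ such that $\|k_a\|_2^2\ge\alpha\|k_a\|_q\|k_a\|_{q'}$ for all $a\in\mathcal{M}_q\cap\mathcal{M}_{q'}$; $SH(p,s)$: there is $\beta>0$ such that $\|k_a\|_{s'}\le\beta\|k_a\|_{p'}\|k_a\|_{q'}$ for all $a\in\mathcal{M}_s$. Then $S$ is $H^s(\sigma)$-interpolating and has the linear extension property in $H^s(\sigma)$: there is a bounded linear operator $E:\ell^s(S)\to H^s(\sigma)$ such that $(E\lambda)(a)=\lambda_a\|k_a\|_{s'}$ for all $\lambda\in\ell^s(S)$ and all $a\in S$.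
   Context: $A$ is a uniform algebra on $X$: a sub-algebra of $\mathcal{C}(X)$ containing $1$ and separating the points of $X$. For $1\le r<\infty$, $H^r(\sigma)$ is the closure of $A$ in $L^r(\sigma)$; $H^\infty(\sigma)$ is the weak-* closure of $A$ in $L^\infty(\sigma)$; $\|\cdot\|_r$ is the $L^r(\sigma)$ norm. $\langle f,g\rangle:=\int_X f\overline g\,d\sigma$ whenever meaningful. $\mathcal{M}$ is the Gelfand spectrum of $A$ (nonzero multiplicative elements of the dual $A'$), and $f(a):=a(f)$ for $a\in\mathcal{M}$, $f\in A$. For $1\le r\le\infty$ with conjugate exponent $r'$, $\mathcal{M}_r$ (the $r$-spectrum) is the set of $a\in\mathcal{M}$ for which there is a (necessarily unique, and independent of $r$) reproducing kernel $k_a\in H^{r'}(\sigma)$ with $f(a)=\langle f,k_a\rangle$ for all $f\in A$; one has $\mathcal{M}_r\subset\mathcal{M}_t$ for $r<t$. For $f\in H^r(\sigma)$ and $a\in\mathcal{M}_r$, $f(a):=\langle f,k_a\rangle$. Put $k_{r,a}:=k_a/\|k_a\|_r$ when $k_a\in H^r(\sigma)$. A sequence $S$ is a finite or countable family of distinct points. $S$ is dual bounded in $H^p(\sigma)$ if there are $\{\rho_a\}_{a\in S}\subset H^p(\sigma)$ with $\sup_{a\in S}\|\rho_a\|_p<\infty$ and $\langle\rho_a,k_{p',b}\rangle=\delta_{ab}$ for all $a,b\in S$. $S\subset\mathcal{M}_{q'}$ is weakly $q$-Carleson ($2\le q<\infty$) if there is $D_q>0$ with $\left\|\sum_{a\in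 S}|\mu_a|^2|k_{q,a}|^2\right\|_{q/2}\le D_q\|\mu\|_{\ell^q}^2$ for all $\mu\in\ell^q(S)$. (For $1\le s<p\le2$ one automatically has $q\ge2$.) $S\subset\mathcal{M}_s$ is $H^s(\sigma)$-interpolating ($1\le s<\infty$) if for every $\lambda\in\ell^s(S)$ there is $f\in H^s(\sigma)$ with $f(a)=\lambda_a\|k_a\|_{s'}$ for all $a\in S$. *)

theory Defs
  imports "HOL-Probability.Probability" "HOL-Probability.Essential_Supremum"
begin

text \<open>
  Exponents range over the closed interval from 1 to infinity, as elements of \<^typ>\<open>ennreal\<close>; there
  \<open>1 / \<infinity> = 0\<close> and \<open>1 / 0 = \<infinity>\<close>, so the formula below also exchanges 1 and infinity.
\<close>

definition conj_exp :: "ennreal \<Rightarrow> ennreal" where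
  "conj_exp r = 1 / (1 - 1 / r)"

subsection \<open>Lebesgue and sequence spaces\<close>

text \<open>Used for finite exponents \<open>r > 0\<close> only.\<close>

definition epowr :: "ennreal \<Rightarrow> real \<Rightarrow> ennreal" where
  "epowr x r = (if x = \<infinity> then \<infinity> else ennreal (enn2real x powr r))"

text \<open>The norm takes the value infinity outside the Lebesgue space.\<close>

definition enn_Lnorm :: "'x measure \<Rightarrow> ennreal \<Rightarrow> ('x \<Rightarrow> ennreal) \<Rightarrow> ennreal" where
  "enn_Lnorm \<sigma> r g =
     (if r = \<infinity> then esssup \<sigma> g
      else epowr (\<integral>\<^sup>+ x. epowr (g x) (enn2real r) \<partial>\<sigma>) (1 / enn2real r))"

definition Lnorm :: "'x measure \<Rightarrow> ennreal \<Rightarrow> ('x \<Rightarrow> complex) \<Rightarrow> ennreal" where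
  "Lnorm \<sigma> r f = enn_Lnorm \<sigma> r (\<lambda>x. ennreal (cmod (f x)))"

text \<open>Elements of Lebesgue spaces are represented by functions; identities between such elements are
  stated almost everywhere.\<close>

definition Lspace :: "'x measure \<Rightarrow> ennreal \<Rightarrow> ('x \<Rightarrow> complex) set" where
  "Lspace \<sigma> r = {f \<in> borel_measurable \<sigma>. Lnorm \<sigma> r f < \<infinity>}"

definition pairing :: "'x measure \<Rightarrow> ('x \<Rightarrow> complex) \<Rightarrow> ('x \<Rightarrow> complex) \<Rightarrow> complex" where
  "pairing \<sigma> f g = (LINT x|\<sigma>. f x * cnj (g x))"

text \<open>Sequences indexed by \<open>S\<close> are functions vanishing off \<open>S\<close>.\<close>

definition lspace :: "'i set \<Rightarrow> real \<Rightarrow> ('i \<Rightarrow> complex) set" where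
  "lspace S r = {\<mu>. (\<forall>a. a \<notin> S \<longrightarrow> \<mu> a = 0) \<and> (\<lambda>a. cmod (\<mu> a) powr r) summable_on S}"

definition lnorm :: "'i set \<Rightarrow> real \<Rightarrow> ('i \<Rightarrow> complex) \<Rightarrow> real" where
  "lnorm S r \<mu> = (\<Sum>\<^sub>\<infinity>a\<in>S. cmod (\<mu> a) powr r) powr (1 / r)"

subsection \<open>Uniform algebras, Hardy spaces and spectra\<close>

text \<open>Closedness in the supremum norm is not required. Since the algebra separates points, the
  underlying space is automatically Hausdorff.\<close>

definition uniform_algebra :: "('x::topological_space \<Rightarrow> complex) set \<Rightarrow> bool" where
  "uniform_algebra A \<longleftrightarrow>
     (\<forall>f\<in>A. continuous_on UNIV f) \<and>
     (\<lambda>x. 1) \<in> A \<and>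
     (\<forall>f\<in>A. \<forall>g\<in>A. (\<lambda>x. f x + g x) \<in> A) \<and>
     (\<forall>f\<in>A. \<forall>g\<in>A. (\<lambda>x. f x * g x) \<in> A) \<and>
     (\<forall>c. \<forall>f\<in>A. (\<lambda>x. c * f x) \<in> A) \<and>
     (\<forall>x y. x \<noteq> y \<longrightarrow> (\<exists>f\<in>A. f x \<noteq> f y))"

text \<open>For infinite exponent this is the closure in the topology on bounded functions induced by
  integration against integrable functions, spelled out with basic neighbourhoods.\<close>

definition Hardy :: "('x \<Rightarrow> complex) set \<Rightarrow> 'x measure \<Rightarrow> ennreal \<Rightarrow> ('x \<Rightarrow> complex) set" where
  "Hardy A \<sigma> r =
     (if r = \<infinity>
      then {f \<in> Lspace \<sigma> \<infinity>. \<forall>F \<epsilon>. finite F \<and> F \<subseteq> Lspace \<sigma> 1 \<and> \<epsilon> > (0::real) \<longrightarrow>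
              (\<exists>g\<in>A. \<forall>h\<in>F. cmod (LINT x|\<sigma>. (f x - g x) * h x) < \<epsilon>)}
      else {f \<in> Lspace \<sigma> r. \<forall>\<epsilon>>0. \<exists>g\<in>A. Lnorm \<sigma> r (\<lambda>x. f x - g x) < ennreal \<epsilon>})"

text \<open>Functionals live on \<open>A\<close>; extensionality makes equality of points of the spectrum mean
  equality on \<open>A\<close>.\<close>

definition gelfand_spectrum ::
    "('x::topological_space \<Rightarrow> complex) set \<Rightarrow> (('x \<Rightarrow> complex) \<Rightarrow> complex) set" where
  "gelfand_spectrum A = {a \<in> extensional A.
     (\<forall>f\<in>A. \<forall>g\<in>A. a (\<lambda>x. f x + g x) = a f + a g) \<and>
     (\<forall>c. \<forall>f\<in>A. a (\<lambda>x. c * f x) = c * a f) \<and>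
     (\<exists>C. \<forall>f\<in>A. cmod (a f) \<le> C * (SUP x. cmod (f x))) \<and>
     (\<forall>f\<in>A. \<forall>g\<in>A. a (\<lambda>x. f x * g x) = a f * a g) \<and>
     (\<exists>f\<in>A. a f \<noteq> 0)}"

definition spectrum ::
    "('x::topological_space \<Rightarrow> complex) set \<Rightarrow> 'x measure \<Rightarrow> ennreal \<Rightarrow>
     (('x \<Rightarrow> complex) \<Rightarrow> complex) set" where
  "spectrum A \<sigma> r = {a \<in> gelfand_spectrum A.
     \<exists>k\<in>Hardy A \<sigma> (conj_exp r). \<forall>f\<in>A. a f = pairing \<sigma> f k}"

text \<open>The reproducing kernel does not depend on the exponent: one function serves for every
  \<open>r\<close>-spectrum containing the point. On the 2-spectrum, which contains the \<open>r\<close>-spectra for \<open>r \<le> 2\<close>,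
  it exists and is unique almost everywhere.\<close>

definition kernel ::
    "('x::topological_space \<Rightarrow> complex) set \<Rightarrow> 'x measure \<Rightarrow> (('x \<Rightarrow> complex) \<Rightarrow> complex) \<Rightarrow>
     'x \<Rightarrow> complex" where
  "kernel A \<sigma> a = (SOME k. (\<forall>f\<in>A. a f = pairing \<sigma> f k) \<and>
     (\<forall>r\<ge>1. a \<in> spectrum A \<sigma> r \<longrightarrow> k \<in> Hardy A \<sigma> (conj_exp r)))"

definition nkernel ::
    "('x::topological_space \<Rightarrow> complex) set \<Rightarrow> 'x measure \<Rightarrow> ennreal \<Rightarrow>
     (('x \<Rightarrow> complex) \<Rightarrow> complex) \<Rightarrow> 'x \<Rightarrow> complex" where
  "nkernel A \<sigma> r a =
     (\<lambda>x. kernel A \<sigma> a x / complex_of_real (enn2real (Lnorm \<sigma> r (kernel A \<sigma> a))))"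

text \<open>Value at \<open>a\<close> of an element of a Hardy space.\<close>

definition Hval ::
    "('x::topological_space \<Rightarrow> complex) set \<Rightarrow> 'x measure \<Rightarrow> ('x \<Rightarrow> complex) \<Rightarrow>
     (('x \<Rightarrow> complex) \<Rightarrow> complex) \<Rightarrow> complex" where
  "Hval A \<sigma> f a = pairing \<sigma> f (kernel A \<sigma> a)"

subsection \<open>Properties of sequences of points and of the measure\<close>

definition dual_bounded ::
    "('x::topological_space \<Rightarrow> complex) set \<Rightarrow> 'x measure \<Rightarrow> ennreal \<Rightarrow>
     (('x \<Rightarrow> complex) \<Rightarrow> complex) set \<Rightarrow> bool" where
  "dual_bounded A \<sigma> p S \<longleftrightarrow>
     (\<exists>\<rho>. (\<forall>a\<in>S. \<rho> a \<in> Hardy A \<sigma> p) \<and>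
          (SUP a\<in>S. Lnorm \<sigma> p (\<rho> a)) < \<infinity> \<and>
          (\<forall>a\<in>S. \<forall>b\<in>S. pairing \<sigma> (\<rho> a) (nkernel A \<sigma> (conj_exp p) b) = (if a = b then 1 else 0)))"

definition weakly_Carleson ::
    "('x::topological_space \<Rightarrow> complex) set \<Rightarrow> 'x measure \<Rightarrow> real \<Rightarrow>
     (('x \<Rightarrow> complex) \<Rightarrow> complex) set \<Rightarrow> bool" where
  "weakly_Carleson A \<sigma> q S \<longleftrightarrow>
     S \<subseteq> spectrum A \<sigma> (conj_exp (ennreal q)) \<and>
     (\<exists>D>0. \<forall>\<mu>\<in>lspace S q.
        enn_Lnorm \<sigma> (ennreal (q / 2))
          (\<lambda>x. \<Sum>\<^sub>\<infinity>a\<in>S. ennreal ((cmod (\<mu> a))\<^sup>2 * (cmod (nkernel A \<sigma> (ennreal q) a x))\<^sup>2))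
        \<le> ennreal (D * (lnorm S q \<mu>)\<^sup>2))"

definition interpolating ::
    "('x::topological_space \<Rightarrow> complex) set \<Rightarrow> 'x measure \<Rightarrow> real \<Rightarrow>
     (('x \<Rightarrow> complex) \<Rightarrow> complex) set \<Rightarrow> bool" where
  "interpolating A \<sigma> s S \<longleftrightarrow>
     S \<subseteq> spectrum A \<sigma> (ennreal s) \<and>
     (\<forall>\<nu>\<in>lspace S s. \<exists>f\<in>Hardy A \<sigma> (ennreal s). \<forall>a\<in>S.
        Hval A \<sigma> f a = \<nu> a *
          complex_of_real (enn2real (Lnorm \<sigma> (conj_exp (ennreal s)) (kernel A \<sigma> a))))"

text \<open>A bounded linear operator from the sequence space to the Hardy space.\<close>

definition bounded_linear_op ::
    "('x \<Rightarrow> complex) set \<Rightarrow> 'x measure \<Rightarrow> real \<Rightarrow> 'i set \<Rightarrow>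
     (('i \<Rightarrow> complex) \<Rightarrow> 'x \<Rightarrow> complex) \<Rightarrow> bool" where
  "bounded_linear_op A \<sigma> s S E \<longleftrightarrow>
     (\<forall>\<nu>\<in>lspace S s. E \<nu> \<in> Hardy A \<sigma> (ennreal s)) \<and>
     (\<forall>\<nu>\<in>lspace S s. \<forall>\<mu>\<in>lspace S s. AE x in \<sigma>. E (\<lambda>a. \<nu> a + \<mu> a) x = E \<nu> x + E \<mu> x) \<and>
     (\<forall>c. \<forall>\<nu>\<in>lspace S s. AE x in \<sigma>. E (\<lambda>a. c * \<nu> a) x = c * E \<nu> x) \<and>
     (\<exists>C. \<forall>\<nu>\<in>lspace S s. Lnorm \<sigma> (ennreal s) (E \<nu>) \<le> ennreal (C * lnorm S s \<nu>))"

definition linear_extension_property ::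
    "('x::topological_space \<Rightarrow> complex) set \<Rightarrow> 'x measure \<Rightarrow> real \<Rightarrow>
     (('x \<Rightarrow> complex) \<Rightarrow> complex) set \<Rightarrow> bool" where
  "linear_extension_property A \<sigma> s S \<longleftrightarrow>
     (\<exists>E. bounded_linear_op A \<sigma> s S E \<and>
        (\<forall>\<nu>\<in>lspace S s. \<forall>a\<in>S.
           Hval A \<sigma> (E \<nu>) a = \<nu> a *
             complex_of_real (enn2real (Lnorm \<sigma> (conj_exp (ennreal s)) (kernel A \<sigma> a)))))"

definition SH_q ::
    "('x::topological_space \<Rightarrow> complex) set \<Rightarrow> 'x measure \<Rightarrow> ennreal \<Rightarrow> bool" where
  "SH_q A \<sigma> q \<longleftrightarrow>
     (\<exists>\<alpha>>0. \<forall>a\<in>spectrum A \<sigma> q \<inter> spectrum A \<sigma> (conj_exp q).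
        (Lnorm \<sigma> 2 (kernel A \<sigma> a))\<^sup>2 \<ge>
          ennreal \<alpha> * Lnorm \<sigma> q (kernel A \<sigma> a) * Lnorm \<sigma> (conj_exp q) (kernel A \<sigma> a))"

text \<open>Here \<open>q\<close> is the third exponent, with \<open>1 / s = 1 / p + 1 / q\<close>.\<close>

definition SH_ps ::
    "('x::topological_space \<Rightarrow> complex) set \<Rightarrow> 'x measure \<Rightarrow> ennreal \<Rightarrow> ennreal \<Rightarrow> ennreal \<Rightarrow> bool" where
  "SH_ps A \<sigma> p s q \<longleftrightarrow>
     (\<exists>\<beta>>0. \<forall>a\<in>spectrum A \<sigma> s.
        Lnorm \<sigma> (conj_exp s) (kernel A \<sigma> a) \<le>
          ennreal \<beta> * Lnorm \<sigma> (conj_exp p) (kernel A \<sigma> a) * Lnorm \<sigma> (conj_exp q) (kernel A \<sigma> a))"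

end

theory Submission
  imports Defs
begin

text \<open>
  Let \<open>\<rho>\<close> be the dual system. The extension operator is
  \<open>E \<nu> = (\<Sum>a. \<nu> a * c a * \<rho> a * k\<^bsub>q,a\<^esub>)\<close> with
  \<open>c a = \<parallel>k\<^sub>a\<parallel>\<^bsub>s'\<^esub> * \<parallel>k\<^sub>a\<parallel>\<^bsub>q\<^esub> / (\<parallel>k\<^sub>a\<parallel>\<^bsub>p'\<^esub> * \<parallel>k\<^sub>a\<parallel>\<^sub>2\<^sup>2)\<close>. Points of the spectrum are
  multiplicative also on products of a function of \<open>H\<^sup>p\<close> with one of \<open>H\<^sup>q\<close>, so the \<open>a\<close>-th term vanishes
  at every \<open>b \<noteq> a\<close> and \<open>E \<nu>\<close> has the prescribed values, while the structural
  hypotheses together say that \<open>c a \<le> \<beta> / \<alpha>\<close>. For the norm, Cauchy--Schwarz in \<open>a\<close> and the Hoelder inequality for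
  \<open>1 / s = 1 / p + 1 / q\<close> separate the \<open>\<rho> a\<close> from the kernels: the latter are controlled by the weak
  Carleson condition, the former because \<open>\<ell>\<^sup>p\<close> is contained in \<open>\<ell>\<^sup>2\<close> for \<open>p \<le> 2\<close>.
\<close>

subsection \<open>Extended powers and Lebesgue norms\<close>

lemma epowr_ennreal: "0 \<le> x \<Longrightarrow> epowr (ennreal x) r = ennreal (x powr r)"
  by (simp add: epowr_def)

lemma epowr_top [simp]: "epowr \<top> r = \<top>"
  by (simp add: epowr_def)

lemma epowr_zero [simp]: "epowr 0 r = 0"
  by (simp add: epowr_def)

lemma epowr_one [simp]: "epowr x 1 = x"
  by (cases x) (auto simp: epowr_def)

lemma epowr_one_left [simp]: "epowr 1 r = 1"
  by (simp add: epowr_def)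

lemma epowr_eq_0_iff [simp]: "epowr x r = 0 \<longleftrightarrow> x = 0"
  by (cases x) (auto simp: epowr_def)

lemma epowr_less_top_iff [simp]: "epowr x r < \<top> \<longleftrightarrow> x < \<top>"
  by (cases x) (auto simp: epowr_def)

lemma epowr_eq_top_iff [simp]: "epowr x r = \<top> \<longleftrightarrow> x = \<top>"
  by (cases x) (auto simp: epowr_def)

lemma epowr_mono: "x \<le> y \<Longrightarrow> 0 \<le> r \<Longrightarrow> epowr x r \<le> epowr y r"
  by (cases x; cases y) (auto simp: epowr_def top_unique intro!: ennreal_leI powr_mono2)

text \<open>Keeping 0 and \<top> fixed for every real exponent agrees with the convention that 0
  times \<top> is 0. Hence this law and the next two hold for all bases and exponents, and later
  estimates need no case distinction.\<close>

lemma epowr_mult: "epowr (x * y) r = epowr x r * epowr y r"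
proof (cases "x = \<top> \<or> y = \<top>")
  case True
  then show ?thesis
    by (metis ennreal_mult_eq_top_iff epowr_eq_0_iff epowr_eq_top_iff mult_eq_0_iff)
next
  case False
  then show ?thesis
    by (cases x; cases y) (auto simp: epowr_ennreal powr_mult simp flip: ennreal_mult')
qed

lemma epowr_epowr: "epowr (epowr x r) t = epowr x (r * t)"
  by (cases x) (auto simp: epowr_ennreal powr_powr)

lemma epowr_add_exp: "epowr x (r + t) = epowr x r * epowr x t"
  by (cases x) (auto simp: epowr_ennreal powr_add ennreal_mult ennreal_top_mult)

lemma epowr_2: "epowr x 2 = x\<^sup>2"
  by (cases x) (auto simp: epowr_ennreal power2_eq_square ennreal_mult powr_numeral)

text \<open>The reason is \<open>x + y \<le> 2 * max x y\<close>. Unlike convexity, this covers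
  every positive exponent; \<open>enn_Lnorm_add_le\<close> applies it to \<open>r\<close> and to
  \<open>1 / r\<close>, one of which is at most 1.\<close>

lemma epowr_add_le:
  assumes "0 < r"
  shows "epowr (x + y) r \<le> ennreal (2 powr r) * (epowr x r + epowr y r)"
proof -
  have "x + y \<le> 2 * max x y"
    by (metis add_mono max.cobounded1 max.cobounded2 mult_2)
  then have "epowr (x + y) r \<le> epowr (2 * max x y) r"
    using assms by (intro epowr_mono) auto
  also have "\<dots> = ennreal (2 powr r) * epowr (max x y) r"
    using epowr_ennreal[of 2 r] by (simp add: epowr_mult)
  also have "epowr (max x y) r \<le> epowr x r + epowr y r"
    by (auto simp: max_def)
  finally show ?thesis
    by (simp add: mult_left_mono)
qed

lemma borel_measurable_epowr [measurable]:
  "f \<in> borel_measurable M \<Longrightarrow> (\<lambda>x. epowr (f x) r) \<in> borel_measurable M"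
proof -
  assume [measurable]: "f \<in> borel_measurable M"
  have [measurable]: "(\<lambda>x. enn2real (f x) powr r) \<in> borel_measurable M"
    by (intro powr_real_measurable) auto
  have [measurable]: "{x \<in> space M. f x = \<infinity>} \<in> sets M"
    by measurable
  show ?thesis unfolding epowr_def by measurable
qed

lemma enn_Lnorm_finite:
  "0 < r \<Longrightarrow> enn_Lnorm M (ennreal r) f = epowr (\<integral>\<^sup>+ x. epowr (f x) r \<partial>M) (1 / r)"
  by (simp add: enn_Lnorm_def)

lemma enn_Lnorm_cong_AE:
  assumes "0 < r" "AE x in M. f x = g x"
  shows "enn_Lnorm M (ennreal r) f = enn_Lnorm M (ennreal r) g"
  using assms(2) unfolding enn_Lnorm_finite[OF assms(1)]
  by (intro arg_cong[where f="\<lambda>x. epowr x _"] nn_integral_cong_AE) auto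

lemma enn_Lnorm_mono_AE:
  assumes "0 < r" "AE x in M. f x \<le> g x"
  shows "enn_Lnorm M (ennreal r) f \<le> enn_Lnorm M (ennreal r) g"
  using assms(2) assms(1) unfolding enn_Lnorm_finite[OF assms(1)]
  by (intro epowr_mono nn_integral_mono_AE) (auto elim!: eventually_mono intro: epowr_mono)

lemma enn_Lnorm_mult_left:
  assumes "0 < r" "f \<in> borel_measurable M"
  shows "enn_Lnorm M (ennreal r) (\<lambda>x. c * f x) = c * enn_Lnorm M (ennreal r) f"
  using assms by (simp add: enn_Lnorm_finite epowr_mult nn_integral_cmult epowr_epowr)

text \<open>Trades a power of the function for a change of exponent. It reduces
  \<open>hoelder\<close> to conjugate exponents and later relates the q-norm of a square function to
  a (q / 2)-norm.\<close>

lemma enn_Lnorm_epowr: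
  assumes "0 < r" "0 < t"
  shows "enn_Lnorm M (ennreal r) (\<lambda>x. epowr (f x) t) = epowr (enn_Lnorm M (ennreal (r * t)) f) t"
  using assms by (simp add: enn_Lnorm_finite epowr_epowr mult.commute)

lemma enn_Lnorm_eq_0:
  assumes "0 < r" "f \<in> borel_measurable M" "enn_Lnorm M (ennreal r) f = 0"
  shows "AE x in M. f x = 0"
  using assms by (simp add: enn_Lnorm_finite nn_integral_0_iff_AE)

section \<open>Young's and Hoelder's inequalities for functions with values in the extended
  half-line\<close>

lemma young_ennreal:
  fixes x y :: ennreal
  assumes "1 < p" "1 < q" "1 / p + 1 / q = 1"
  shows "x * y \<le> ennreal (1 / p) * epowr x p + ennreal (1 / q) * epowr y q"
proof (cases "x = \<top> \<or> y = \<top>")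
  case True
  then show ?thesis using assms by (auto simp: ennreal_mult_top)
next
  case False
  then obtain a b where "x = ennreal a" "y = ennreal b" "0 \<le> a" "0 \<le> b"
    by (metis ennreal_cases)
  with Youngs_inequality[OF assms, of a b] show ?thesis using assms
    by (auto simp: epowr_ennreal ennreal_leI simp flip: ennreal_mult ennreal_plus)
qed

text \<open>Dividing each function by its norm reduces the claim to norm one, where integrating
  Young's inequality gives 1 / p + 1 / q = 1. Norms 0 and infinity do not allow the division and are
  settled first.\<close>

lemma hoelder_1:
  fixes f g :: "'a \<Rightarrow> ennreal"
  assumes pq: "1 < p" "1 < q" "1 / p + 1 / q = 1"
    and [measurable]: "f \<in> borel_measurable M" "g \<in> borel_measurable M"
  shows "(\<integral>\<^sup>+ x. f x * g x \<partial>M) \<le> enn_Lnorm M (ennreal p) f * enn_Lnorm M (ennreal q) g"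
proof -
  define F where "F = enn_Lnorm M (ennreal p) f"
  define G where "G = enn_Lnorm M (ennreal q) g"
  have p0: "0 < p" "0 < q" using pq by auto
  consider "F = 0 \<or> G = 0" | "F \<noteq> 0" "G \<noteq> 0" "F = \<top> \<or> G = \<top>"
    | "F \<noteq> 0" "G \<noteq> 0" "F \<noteq> \<top>" "G \<noteq> \<top>" by blast
  then show ?thesis
  proof cases
    case 1
    \<comment> \<open>A vanishing norm makes the product vanish almost everywhere, so the case of
      norms 0 and infinity agrees with the product of the norms being 0.\<close>
    then have "AE x in M. f x * g x = 0"
      using enn_Lnorm_eq_0[of p f M] enn_Lnorm_eq_0[of q g M] p0 unfolding F_def G_def by auto
    then have "(\<integral>\<^sup>+ x. f x * g x \<partial>M) = 0"
      by (subst nn_integral_0_iff_AE) auto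
    then show ?thesis by simp
  next
    case 2
    then show ?thesis unfolding F_def G_def by (auto simp: ennreal_top_mult ennreal_mult_top)
  next
    case 3
    then obtain a b where ab: "F = ennreal a" "G = ennreal b" "0 < a" "0 < b"
      by (metis ennreal_cases ennreal_0 less_eq_real_def)
    have Fp: "(\<integral>\<^sup>+ x. epowr (f x) p \<partial>M) = epowr F p" "(\<integral>\<^sup>+ x. epowr (g x) q \<partial>M) = epowr G q"
      using p0 by (simp_all add: F_def G_def enn_Lnorm_finite epowr_epowr)
    have norm1: "epowr (ennreal (1 / a)) p * epowr F p = 1" "epowr (ennreal (1 / b)) q * epowr G q = 1"
      using ab by (simp_all flip: epowr_mult ennreal_mult)
    have "(\<integral>\<^sup>+ x. f x * g x \<partial>M)
        = (\<integral>\<^sup>+ x. (F * G) * ((ennreal (1 / a) * f x) * (ennreal (1 / b) * g x)) \<partial>M)"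
    proof (rule nn_integral_cong)
      fix x
      have "F * G * (ennreal (1 / a) * f x * (ennreal (1 / b) * g x))
          = (F * ennreal (1 / a)) * (G * ennreal (1 / b)) * (f x * g x)"
        by (simp only: ac_simps)
      also have "\<dots> = f x * g x"
        using ab by (simp flip: ennreal_mult)
      finally show "f x * g x = F * G * (ennreal (1 / a) * f x * (ennreal (1 / b) * g x))" by simp
    qed
    also have "\<dots> \<le> (\<integral>\<^sup>+ x. (F * G) * (ennreal (1 / p) * (epowr (ennreal (1 / a)) p * epowr (f x) p)
         + ennreal (1 / q) * (epowr (ennreal (1 / b)) q * epowr (g x) q)) \<partial>M)"
      unfolding epowr_mult[symmetric] by (intro nn_integral_mono mult_left_mono young_ennreal pq) auto
    also have "\<dots> = (F * G) * (ennreal (1 / p) * (epowr (ennreal (1 / a)) p * epowr F p)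
         + ennreal (1 / q) * (epowr (ennreal (1 / b)) q * epowr G q))"
      by (simp add: nn_integral_cmult nn_integral_add Fp)
    also have "\<dots> = F * G"
      using pq by (simp add: norm1 flip: ennreal_plus)
    finally show ?thesis by (simp add: F_def G_def)
  qed
qed

lemma hoelder:
  fixes f g :: "'a \<Rightarrow> ennreal"
  assumes pos: "0 < s" "0 < p" "0 < q" and spq: "1 / s = 1 / p + 1 / q"
    and [measurable]: "f \<in> borel_measurable M" "g \<in> borel_measurable M"
  shows "enn_Lnorm M (ennreal s) (\<lambda>x. f x * g x)
    \<le> enn_Lnorm M (ennreal p) f * enn_Lnorm M (ennreal q) g"
proof -
  \<comment> \<open>Multiplying the relation by \<open>s\<close> shows that \<open>p / s\<close> and
    \<open>q / s\<close> are conjugate; Hoelder is then applied to the s-th powers of both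
    functions.\<close>
  have "s * (1 / s) = s / p + s / q" unfolding spq by (simp add: field_simps)
  then have 1: "s / p + s / q = 1" using pos by simp
  then have 2: "s < p" "s < q" using pos
    by (smt (verit, best) divide_pos_pos less_divide_eq_1_pos not_less_iff_gr_or_eq divide_self)+
  have "(\<integral>\<^sup>+ x. epowr (f x) s * epowr (g x) s \<partial>M) \<le>
     enn_Lnorm M (ennreal (p / s)) (\<lambda>x. epowr (f x) s) * enn_Lnorm M (ennreal (q / s)) (\<lambda>x. epowr (g x) s)"
    using pos 1 2 by (intro hoelder_1) auto
  also have "\<dots> = epowr (enn_Lnorm M (ennreal p) f * enn_Lnorm M (ennreal q) g) s"
    using pos by (simp add: enn_Lnorm_epowr epowr_mult)
  finally have "epowr (\<integral>\<^sup>+ x. epowr (f x) s * epowr (g x) s \<partial>M) (1 / s)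
      \<le> epowr (epowr (enn_Lnorm M (ennreal p) f * enn_Lnorm M (ennreal q) g) s) (1 / s)"
    using pos by (intro epowr_mono) auto
  then show ?thesis
    using pos by (simp add: enn_Lnorm_finite epowr_epowr epowr_mult)
qed

text \<open>The constant is not sharp; any constant suffices for the density arguments, and Minkowski's
  inequality is avoided.\<close>

lemma enn_Lnorm_add_le:
  assumes r: "0 < r" and [measurable]: "f \<in> borel_measurable M" "g \<in> borel_measurable M"
  shows "enn_Lnorm M (ennreal r) (\<lambda>x. f x + g x)
    \<le> ennreal (2 * 2 powr (1 / r)) * (enn_Lnorm M (ennreal r) f + enn_Lnorm M (ennreal r) g)"
proof -
  let ?I = "\<lambda>h. \<integral>\<^sup>+ x. epowr (h x) r \<partial>M"
  have "?I (\<lambda>x. f x + g x) \<le> (\<integral>\<^sup>+ x. ennreal (2 powr r) * (epowr (f x) r + epowr (g x) r) \<partial>M)"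
    by (intro nn_integral_mono epowr_add_le r)
  also have "\<dots> = ennreal (2 powr r) * (?I f + ?I g)"
    by (simp add: nn_integral_cmult nn_integral_add)
  finally have "enn_Lnorm M (ennreal r) (\<lambda>x. f x + g x)
      \<le> epowr (ennreal (2 powr r) * (?I f + ?I g)) (1 / r)"
    using r by (simp add: enn_Lnorm_finite epowr_mono)
  also have "\<dots> = 2 * epowr (?I f + ?I g) (1 / r)"
    using r by (simp add: epowr_mult epowr_ennreal powr_powr)
  also have "\<dots> \<le> 2 * (ennreal (2 powr (1 / r)) * (epowr (?I f) (1 / r) + epowr (?I g) (1 / r)))"
    using r by (intro mult_left_mono epowr_add_le) auto
  also have "\<dots> = ennreal (2 * 2 powr (1 / r)) * (enn_Lnorm M (ennreal r) f + enn_Lnorm M (ennreal r) g)"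
    using r by (simp add: enn_Lnorm_finite ennreal_mult mult.assoc)
  finally show ?thesis .
qed

lemma (in prob_space) enn_Lnorm_le_exponent:
  assumes "0 < r" "r \<le> t" and [measurable]: "f \<in> borel_measurable M"
  shows "enn_Lnorm M (ennreal r) f \<le> enn_Lnorm M (ennreal t) f"
proof (cases "r = t")
  case False
  \<comment> \<open>\<open>u\<close> is the complementary exponent: Hoelder against the constant 1,
    which has norm 1 on a probability space, raises the exponent from \<open>r\<close> to
    \<open>t\<close>.\<close>
  define u where "u = 1 / (1 / r - 1 / t)"
  have u: "0 < u" "1 / r = 1 / t + 1 / u"
    using assms False by (auto simp: u_def frac_less2)
  have "enn_Lnorm M (ennreal r) (\<lambda>x. f x * 1) \<le> enn_Lnorm M (ennreal t) f * enn_Lnorm M (ennreal u) (\<lambda>x. 1)"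
    using assms u by (intro hoelder) auto
  also have "enn_Lnorm M (ennreal u) (\<lambda>x. 1) = 1"
    using u by (simp add: enn_Lnorm_finite emeasure_space_1)
  finally show ?thesis by simp
qed simp

lemma enn_Lnorm_top: "enn_Lnorm M \<top> f = esssup M f"
  by (simp add: enn_Lnorm_def)

lemma (in prob_space) enn_Lnorm_le_top:
  assumes "0 < r"
  shows "enn_Lnorm M (ennreal r) f \<le> enn_Lnorm M \<top> f"
proof -
  have "AE x in M. f x \<le> esssup M f" by (rule esssup_AE)
  then have "enn_Lnorm M (ennreal r) f \<le> enn_Lnorm M (ennreal r) (\<lambda>x. esssup M f)"
    by (rule enn_Lnorm_mono_AE[OF assms])
  also have "\<dots> = enn_Lnorm M \<top> f"
    using assms by (simp add: enn_Lnorm_finite enn_Lnorm_top emeasure_space_1 epowr_epowr)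
  finally show ?thesis .
qed

section \<open>Conjugate exponents, including the endpoint\<close>

lemma conj_exp_1: "conj_exp (ennreal 1) = \<top>"
  by (simp add: conj_exp_def)

lemma conj_exp_finite: "1 < r \<Longrightarrow> conj_exp (ennreal r) = ennreal (r / (r - 1))"
  by (simp add: conj_exp_def divide_ennreal ennreal_minus diff_divide_distrib[symmetric]
      field_simps flip: ennreal_1)

text \<open>Subtraction of extended nonnegative reals truncates, so \<open>1 - 1 / r\<close> lies
  between 0 and 1 for every \<open>r\<close>, and its reciprocal is at least 1, infinity
  included.\<close>

lemma conj_exp_ge_1: "1 \<le> conj_exp r"
proof -
  have "1 - 1 / r \<le> 1" by (rule diff_le_self_ennreal)
  show ?thesis
  proof (cases "1 - 1 / r = 0")
    case True
    then show ?thesis by (simp add: conj_exp_def)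
  next
    case False
    with \<open>1 - 1 / r \<le> 1\<close> show ?thesis
      unfolding conj_exp_def
      by (metis divide_right_mono_ennreal ennreal_divide_self ennreal_one_less_top order_le_less_trans less_top)
  qed
qed

lemma hoelder_conj:
  assumes r: "1 \<le> r" and [measurable]: "f \<in> borel_measurable M" "g \<in> borel_measurable M"
  shows "(\<integral>\<^sup>+ x. f x * g x \<partial>M) \<le> enn_Lnorm M (ennreal r) f * enn_Lnorm M (conj_exp (ennreal r)) g"
proof (cases "r = 1")
  case True
  have "AE x in M. g x \<le> esssup M g" by (rule esssup_AE)
  then have "(\<integral>\<^sup>+ x. f x * g x \<partial>M) \<le> (\<integral>\<^sup>+ x. f x * esssup M g \<partial>M)"
    by (intro nn_integral_mono_AE) (auto elim!: eventually_mono intro: mult_left_mono)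
  also have "\<dots> = enn_Lnorm M (ennreal 1) f * esssup M g"
    by (subst enn_Lnorm_finite) (auto simp: nn_integral_multc)
  finally show ?thesis using True conj_exp_1 by (simp add: enn_Lnorm_top)
next
  case False
  with r have "1 < r" by simp
  moreover from this have "1 / r + 1 / (r / (r - 1)) = 1" "1 < r / (r - 1)" by (auto simp: field_simps)
  ultimately show ?thesis using hoelder_1[of r "r / (r - 1)" f M g] by (simp add: conj_exp_finite)
qed

lemma tendsto_0_ennreal_le:
  fixes f g :: "'a \<Rightarrow> ennreal"
  assumes "(g \<longlongrightarrow> 0) F" "\<And>x. f x \<le> g x"
  shows "(f \<longlongrightarrow> 0) F"
  using assms by (intro tendsto_sandwich[of "\<lambda>_. 0" f F g]) auto

lemma tendsto_0_ennreal_cmult: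
  fixes f :: "'a \<Rightarrow> ennreal"
  assumes "(f \<longlongrightarrow> 0) F" "c < \<top>"
  shows "((\<lambda>x. c * f x) \<longlongrightarrow> 0) F"
  using ennreal_tendsto_cmult[of c f 0 F] assms by simp

section \<open>Lebesgue norms of complex functions\<close>

lemma Lnorm_cong_AE:
  "0 < r \<Longrightarrow> AE x in M. f x = g x \<Longrightarrow> Lnorm M (ennreal r) f = Lnorm M (ennreal r) g"
  unfolding Lnorm_def by (rule enn_Lnorm_cong_AE) (auto elim!: eventually_mono)

lemma Lnorm_cmult:
  "0 < r \<Longrightarrow> f \<in> borel_measurable M \<Longrightarrow>
    Lnorm M (ennreal r) (\<lambda>x. c * f x) = ennreal (cmod c) * Lnorm M (ennreal r) f"
  by (simp add: Lnorm_def norm_mult ennreal_mult enn_Lnorm_mult_left)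

lemma Lnorm_add_le:
  assumes r: "0 < r" and [measurable]: "f \<in> borel_measurable M" "g \<in> borel_measurable M"
  shows "Lnorm M (ennreal r) (\<lambda>x. f x + g x)
    \<le> ennreal (2 * 2 powr (1 / r)) * (Lnorm M (ennreal r) f + Lnorm M (ennreal r) g)"
proof -
  have "Lnorm M (ennreal r) (\<lambda>x. f x + g x)
      \<le> enn_Lnorm M (ennreal r) (\<lambda>x. ennreal (cmod (f x)) + ennreal (cmod (g x)))"
    unfolding Lnorm_def
    by (intro enn_Lnorm_mono_AE r AE_I2) (simp add: norm_triangle_ineq flip: ennreal_plus)
  also have "\<dots> \<le> ennreal (2 * 2 powr (1 / r)) * (Lnorm M (ennreal r) f + Lnorm M (ennreal r) g)"
    unfolding Lnorm_def by (intro enn_Lnorm_add_le r) auto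
  finally show ?thesis .
qed

lemma Lnorm_minus_commute: "Lnorm M r (\<lambda>x. f x - g x) = Lnorm M r (\<lambda>x. g x - f x)"
  by (simp add: Lnorm_def norm_minus_commute)

lemma Lnorm_mult_le:
  assumes "0 < s" "0 < p" "0 < q" "1 / s = 1 / p + 1 / q"
    and [measurable]: "f \<in> borel_measurable M" "g \<in> borel_measurable M"
  shows "Lnorm M (ennreal s) (\<lambda>x. f x * g x) \<le> Lnorm M (ennreal p) f * Lnorm M (ennreal q) g"
  unfolding Lnorm_def norm_mult using assms by (simp add: ennreal_mult hoelder)

lemma (in prob_space) Lnorm_le_exponent:
  "0 < r \<Longrightarrow> r \<le> t \<Longrightarrow> f \<in> borel_measurable M \<Longrightarrow> Lnorm M (ennreal r) f \<le> Lnorm M (ennreal t) f"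
  unfolding Lnorm_def by (intro enn_Lnorm_le_exponent) auto

lemma (in prob_space) Lnorm_le_top:
  "0 < r \<Longrightarrow> Lnorm M (ennreal r) f \<le> Lnorm M \<top> f"
  unfolding Lnorm_def by (rule enn_Lnorm_le_top)

lemma Lspace_measurable: "f \<in> Lspace M r \<Longrightarrow> f \<in> borel_measurable M"
  by (simp add: Lspace_def)

lemma Lspace_add:
  assumes "0 < r" "f \<in> Lspace M (ennreal r)" "g \<in> Lspace M (ennreal r)"
  shows "(\<lambda>x. f x + g x) \<in> Lspace M (ennreal r)"
  using Lnorm_add_le[of r f M g] assms
  by (auto simp: Lspace_def ennreal_mult_less_top intro: order_le_less_trans)

lemma Lspace_cmult:
  assumes "0 < r" "f \<in> Lspace M (ennreal r)"
  shows "(\<lambda>x. c * f x) \<in> Lspace M (ennreal r)"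
  using assms by (auto simp: Lspace_def Lnorm_cmult ennreal_mult_less_top)

lemma Lspace_diff:
  assumes "0 < r" "f \<in> Lspace M (ennreal r)" "g \<in> Lspace M (ennreal r)"
  shows "(\<lambda>x. f x - g x) \<in> Lspace M (ennreal r)"
  using Lspace_add[OF assms(1,2) Lspace_cmult[OF assms(1,3), of "-1"]] by simp

section \<open>The sesquilinear pairing and its continuity\<close>

lemma borel_measurable_cnj [measurable (raw)]:
  "f \<in> borel_measurable M \<Longrightarrow> (\<lambda>x. cnj (f x)) \<in> borel_measurable M"
  by (rule measurable_compose[OF _ borel_measurable_continuous_onI]) (auto intro!: continuous_intros)

lemma pairing_integrable_bound:
  assumes r: "1 \<le> r" and f: "f \<in> Lspace M (ennreal r)" and k: "k \<in> Lspace M (conj_exp (ennreal r))"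
  shows "integrable M (\<lambda>x. f x * cnj (k x))"
    and "ennreal (cmod (pairing M f k)) \<le> Lnorm M (ennreal r) f * Lnorm M (conj_exp (ennreal r)) k"
proof -
  have [measurable]: "f \<in> borel_measurable M" "k \<in> borel_measurable M"
    using f k by (auto simp: Lspace_def)
  have [measurable]: "(\<lambda>x. f x * cnj (k x)) \<in> borel_measurable M"
    by measurable
  have "(\<integral>\<^sup>+ x. ennreal (cmod (f x * cnj (k x))) \<partial>M)
      \<le> Lnorm M (ennreal r) f * Lnorm M (conj_exp (ennreal r)) k"
    unfolding Lnorm_def norm_mult ennreal_mult[OF norm_ge_zero norm_ge_zero] complex_mod_cnj
    by (intro hoelder_conj r) auto
  moreover from this f k show "integrable M (\<lambda>x. f x * cnj (k x))"
    by (intro integrableI_bounded) (auto simp: Lspace_def ennreal_mult_less_top intro: order_le_less_trans)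
  ultimately show "ennreal (cmod (pairing M f k)) \<le> Lnorm M (ennreal r) f * Lnorm M (conj_exp (ennreal r)) k"
    unfolding pairing_def using integral_norm_bound_ennreal order_trans by blast
qed

lemma pairing_cmult: "pairing M (\<lambda>x. c * f x) k = c * pairing M f k"
  by (simp add: pairing_def mult.assoc)

lemma pairing_cmult_right: "pairing M f (\<lambda>x. c * k x) = cnj c * pairing M f k"
proof -
  have "(\<lambda>x. f x * cnj (c * k x)) = (\<lambda>x. cnj c * (f x * cnj (k x)))" by auto
  then show ?thesis by (simp add: pairing_def)
qed

lemma pairing_diff:
  assumes "1 \<le> r" "f \<in> Lspace M (ennreal r)" "g \<in> Lspace M (ennreal r)"
    and "k \<in> Lspace M (conj_exp (ennreal r))"
  shows "pairing M (\<lambda>x. f x - g x) k = pairing M f k - pairing M g k"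
  using pairing_integrable_bound(1)[OF assms(1,2,4)] pairing_integrable_bound(1)[OF assms(1,3,4)]
  by (simp add: pairing_def ring_distribs)

text \<open>By Hoelder, pairing with a fixed function of the dual exponent is continuous. The filter
  is arbitrary because both sequences of approximants and nets of finite partial sums are sent
  through this lemma.\<close>

lemma pairing_tendsto:
  assumes r: "1 \<le> r" and f: "\<And>n. f n \<in> Lspace M (ennreal r)" and g: "g \<in> Lspace M (ennreal r)"
    and k: "k \<in> Lspace M (conj_exp (ennreal r))"
    and lim: "((\<lambda>n. Lnorm M (ennreal r) (\<lambda>x. g x - f n x)) \<longlongrightarrow> 0) F"
  shows "((\<lambda>n. pairing M (f n) k) \<longlongrightarrow> pairing M g k) F"
proof -
  have b: "ennreal (cmod (pairing M g k - pairing M (f n) k))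
      \<le> Lnorm M (conj_exp (ennreal r)) k * Lnorm M (ennreal r) (\<lambda>x. g x - f n x)" for n
    using pairing_integrable_bound(2)[OF r Lspace_diff[OF _ g f] k, of n] r
    by (simp add: pairing_diff[OF r g f k] mult.commute)
  have "((\<lambda>n. ennreal (cmod (pairing M g k - pairing M (f n) k))) \<longlongrightarrow> 0) F"
    using k by (intro tendsto_0_ennreal_le[OF tendsto_0_ennreal_cmult[OF lim] b]) (auto simp: Lspace_def)
  then have "((\<lambda>n. cmod (pairing M (f n) k - pairing M g k)) \<longlongrightarrow> 0) F"
    by (simp add: norm_minus_commute flip: ennreal_0)
  then show ?thesis
    by (simp add: LIM_zero_iff tendsto_norm_zero_iff)
qed

lemma conj_exp_conj_exp:
  assumes "1 < r"
  shows "conj_exp (conj_exp (ennreal r)) = ennreal r"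
proof -
  have "1 < r / (r - 1)" "r / (r - 1) / (r / (r - 1) - 1) = r"
    using assms by (simp_all add: field_simps)
  then show ?thesis
    using assms conj_exp_finite[of r] conj_exp_finite[of "r / (r - 1)"] by simp
qed

lemma conj_exp_2: "conj_exp 2 = 2"
  using conj_exp_finite[of 2] by simp

lemma (in prob_space) Lspace_antimono:
  assumes "0 < r" "ennreal r \<le> t" "f \<in> Lspace M t"
  shows "f \<in> Lspace M (ennreal r)"
proof (cases t)
  case (real u)
  then have "Lnorm M (ennreal r) f \<le> Lnorm M t f"
    using assms Lspace_measurable[OF assms(3)] by (auto intro!: Lnorm_le_exponent)
  then show ?thesis using assms by (auto simp: Lspace_def)
next
  case top
  then show ?thesis
    using assms Lnorm_le_top[of r f] by (auto simp: Lspace_def)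
qed

text \<open>Serves twice: a function orthogonal to itself has norm 0, which gives uniqueness of
  kernels, and the value of a kernel at its own point is its squared 2-norm.\<close>

lemma Lnorm_2_sq_eq_pairing:
  assumes "f \<in> Lspace M 2"
  shows "(Lnorm M 2 f)\<^sup>2 = ennreal (Re (pairing M f f))" "Im (pairing M f f) = 0"
proof -
  have [measurable]: "f \<in> borel_measurable M" using assms by (rule Lspace_measurable)
  have int: "integrable M (\<lambda>x. f x * cnj (f x))"
    using pairing_integrable_bound(1)[of 2 f M f] assms by (simp add: conj_exp_2)
  have eq: "f x * cnj (f x) = complex_of_real ((cmod (f x))\<^sup>2)" for x
    by (rule complex_norm_square[symmetric, unfolded of_real_power[symmetric]])
  have int': "integrable M (\<lambda>x. (cmod (f x))\<^sup>2)"
    using int unfolding eq complex_of_real_integrable_eq .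
  have p: "pairing M f f = complex_of_real (LINT x|M. (cmod (f x))\<^sup>2)"
    unfolding pairing_def eq by (rule integral_complex_of_real)
  have "(Lnorm M 2 f)\<^sup>2 = epowr (Lnorm M (ennreal 2) f) 2"
    by (simp add: epowr_2)
  also have "\<dots> = (\<integral>\<^sup>+ x. ennreal ((cmod (f x))\<^sup>2) \<partial>M)"
    unfolding Lnorm_def by (subst enn_Lnorm_finite) (auto simp: epowr_epowr epowr_ennreal simp flip: epowr_2)
  also have "\<dots> = ennreal (LINT x|M. (cmod (f x))\<^sup>2)"
    by (rule nn_integral_eq_integral[OF int']) simp
  finally show "(Lnorm M 2 f)\<^sup>2 = ennreal (Re (pairing M f f))" by (simp add: p)
  show "Im (pairing M f f) = 0" by (simp add: p)
qed

lemma Lnorm_eq_0: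
  "0 < r \<Longrightarrow> f \<in> borel_measurable M \<Longrightarrow> Lnorm M (ennreal r) f = 0 \<Longrightarrow> AE x in M. f x = 0"
  unfolding Lnorm_def by (drule enn_Lnorm_eq_0[rotated 2]) auto

subsection \<open>Hardy spaces\<close>

locale hardy_setting = prob_space \<sigma> for \<sigma> :: "'x::topological_space measure" +
  fixes A :: "('x \<Rightarrow> complex) set"
  assumes compact_space: "compact (UNIV :: 'x set)"
    and alg: "uniform_algebra A"
    and sets_eq: "sets \<sigma> = sets borel"
begin

lemma A_add: "f \<in> A \<Longrightarrow> g \<in> A \<Longrightarrow> (\<lambda>x. f x + g x) \<in> A"
  and A_mult: "f \<in> A \<Longrightarrow> g \<in> A \<Longrightarrow> (\<lambda>x. f x * g x) \<in> A"
  and A_cmult: "f \<in> A \<Longrightarrow> (\<lambda>x. c * f x) \<in> A"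
  and A_one: "(\<lambda>x. 1) \<in> A"
  and A_continuous: "f \<in> A \<Longrightarrow> continuous_on UNIV f"
proof -
  have *: "\<forall>f\<in>A. continuous_on UNIV f" "\<forall>f\<in>A. \<forall>g\<in>A. (\<lambda>x. f x + g x) \<in> A"
    "\<forall>f\<in>A. \<forall>g\<in>A. (\<lambda>x. f x * g x) \<in> A" "\<forall>c. \<forall>f\<in>A. (\<lambda>x. c * f x) \<in> A" "(\<lambda>x. 1) \<in> A"
    using alg unfolding uniform_algebra_def by - (elim conjE, assumption)+
  show "f \<in> A \<Longrightarrow> g \<in> A \<Longrightarrow> (\<lambda>x. f x + g x) \<in> A"
    "f \<in> A \<Longrightarrow> g \<in> A \<Longrightarrow> (\<lambda>x. f x * g x) \<in> A"
    by (rule bspec[OF bspec[OF *(2)]], assumption+) (rule bspec[OF bspec[OF *(3)]], assumption+)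
  show "f \<in> A \<Longrightarrow> (\<lambda>x. c * f x) \<in> A" "(\<lambda>x. 1) \<in> A" "f \<in> A \<Longrightarrow> continuous_on UNIV f"
    by (rule bspec[OF spec[OF *(4)]], assumption) (rule *(5), rule bspec[OF *(1)])
qed

lemma A_measurable: "f \<in> A \<Longrightarrow> f \<in> borel_measurable \<sigma>"
  unfolding measurable_cong_sets[OF sets_eq refl]
  by (rule borel_measurable_continuous_onI[OF A_continuous])

lemma A_Lspace:
  assumes "f \<in> A" "0 < r"
  shows "f \<in> Lspace \<sigma> (ennreal r)"
proof -
  have "compact (range f)"
    by (rule compact_continuous_image[OF A_continuous[OF assms(1)] compact_space])
  then obtain B where B: "\<And>x. cmod (f x) \<le> B"
    using compact_imp_bounded by (fastforce simp: bounded_iff)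
  have "Lnorm \<sigma> (ennreal r) f \<le> Lnorm \<sigma> \<top> f" by (rule Lnorm_le_top[OF assms(2)])
  also have "\<dots> \<le> ennreal B"
    unfolding Lnorm_def enn_Lnorm_top using A_measurable[OF assms(1)] B
    by (intro esssup_I) (auto intro!: ennreal_leI)
  finally show ?thesis
    using A_measurable[OF assms(1)] by (auto simp: Lspace_def intro: order_le_less_trans)
qed

lemma Hardy_Lspace: "f \<in> Hardy A \<sigma> r \<Longrightarrow> f \<in> Lspace \<sigma> r"
  by (simp add: Hardy_def split: if_splits)

lemma Hardy_measurable: "f \<in> Hardy A \<sigma> r \<Longrightarrow> f \<in> borel_measurable \<sigma>"
  by (blast intro: Lspace_measurable Hardy_Lspace)

lemma A_Hardy:
  assumes "f \<in> A" "0 < r"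
  shows "f \<in> Hardy A \<sigma> (ennreal r)"
  using A_Lspace[OF assms] assms
  by (auto simp: Hardy_def Lnorm_def enn_Lnorm_finite intro!: bexI[of _ f])

lemma Hardy_approx:
  assumes "0 < r" "f \<in> Hardy A \<sigma> (ennreal r)"
  obtains g where "\<And>n. g n \<in> A" "(\<lambda>n. Lnorm \<sigma> (ennreal r) (\<lambda>x. f x - g n x)) \<longlonglongrightarrow> 0"
proof -
  have "\<exists>g\<in>A. Lnorm \<sigma> (ennreal r) (\<lambda>x. f x - g x) < ennreal (inverse (real (Suc n)))" for n
    using assms by (auto simp: Hardy_def)
  then obtain g where g: "\<And>n. g n \<in> A"
      "\<And>n. Lnorm \<sigma> (ennreal r) (\<lambda>x. f x - g n x) < ennreal (inverse (real (Suc n)))"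
    by metis
  have "(\<lambda>n. ennreal (inverse (real (Suc n)))) \<longlonglongrightarrow> 0"
    using tendsto_ennrealI[OF LIMSEQ_inverse_real_of_nat] by simp
  then have "(\<lambda>n. Lnorm \<sigma> (ennreal r) (\<lambda>x. f x - g n x)) \<longlonglongrightarrow> 0"
    by (rule tendsto_0_ennreal_le) (rule less_imp_le[OF g(2)])
  with g(1) show ?thesis by (rule that)
qed

text \<open>An element of \<open>A\<close> close to \<open>h n\<close> is close to \<open>f\<close>
  up to the quasi-triangle constant. Finiteness of the norm of \<open>f\<close> is a by-product:
  \<open>f\<close> is an element of \<open>A\<close> plus a function of small norm.\<close>

lemma Hardy_closed:
  assumes r: "0 < r" and h: "\<And>n::nat. h n \<in> Hardy A \<sigma> (ennreal r)"
    and f [measurable]: "f \<in> borel_measurable \<sigma>"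
    and lim: "(\<lambda>n. Lnorm \<sigma> (ennreal r) (\<lambda>x. f x - h n x)) \<longlonglongrightarrow> 0"
  shows "f \<in> Hardy A \<sigma> (ennreal r)"
proof -
  define K where "K = ennreal (2 * 2 powr (1 / r))"
  have K: "K < \<top>" by (simp add: K_def)
  note [measurable] = Hardy_measurable[OF h] A_measurable
  have "\<exists>g\<in>A. Lnorm \<sigma> (ennreal r) (\<lambda>x. h n x - g x) < ennreal (inverse (real (Suc n)))" for n
    using h[of n] by (auto simp: Hardy_def)
  then obtain g where g [measurable]: "\<And>n. g n \<in> A"
    and hg: "\<And>n. Lnorm \<sigma> (ennreal r) (\<lambda>x. h n x - g n x) < ennreal (inverse (real (Suc n)))"
    by metis
  have "(\<lambda>n. ennreal (inverse (real (Suc n)))) \<longlonglongrightarrow> 0"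
    using tendsto_ennrealI[OF LIMSEQ_inverse_real_of_nat] by simp
  then have "(\<lambda>n. Lnorm \<sigma> (ennreal r) (\<lambda>x. h n x - g n x)) \<longlonglongrightarrow> 0"
    by (rule tendsto_0_ennreal_le) (rule less_imp_le[OF hg])
  from tendsto_add[OF lim this]
  have *: "(\<lambda>n. K * (Lnorm \<sigma> (ennreal r) (\<lambda>x. f x - h n x) + Lnorm \<sigma> (ennreal r) (\<lambda>x. h n x - g n x))) \<longlonglongrightarrow> 0"
    by (intro tendsto_0_ennreal_cmult K) simp
  have "Lnorm \<sigma> (ennreal r) (\<lambda>x. f x - g n x)
     \<le> K * (Lnorm \<sigma> (ennreal r) (\<lambda>x. f x - h n x) + Lnorm \<sigma> (ennreal r) (\<lambda>x. h n x - g n x))" for n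
    using Lnorm_add_le[OF r, of "\<lambda>x. f x - h n x" \<sigma> "\<lambda>x. h n x - g n x"]
      Hardy_measurable[OF h] A_measurable[OF g] by (simp add: K_def)
  then have **: "(\<lambda>n. Lnorm \<sigma> (ennreal r) (\<lambda>x. f x - g n x)) \<longlonglongrightarrow> 0"
    by (rule tendsto_0_ennreal_le[OF *])
  have ex: "\<exists>g\<in>A. Lnorm \<sigma> (ennreal r) (\<lambda>x. f x - g x) < ennreal \<epsilon>" if "\<epsilon> > 0" for \<epsilon>
  proof -
    have "\<forall>\<^sub>F n in sequentially. Lnorm \<sigma> (ennreal r) (\<lambda>x. f x - g n x) < ennreal \<epsilon>"
      using order_tendstoD(2)[OF **, of "ennreal \<epsilon>"] that by simp
    then show ?thesis
      using g by (auto simp: eventually_sequentially)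
  qed
  from ex[of 1] obtain u where u: "u \<in> A" "Lnorm \<sigma> (ennreal r) (\<lambda>x. f x - u x) < 1" by auto
  have "(\<lambda>x. f x - u x) \<in> Lspace \<sigma> (ennreal r)"
    using u A_measurable[OF u(1)] by (auto simp: Lspace_def intro: less_trans)
  from Lspace_add[OF r this A_Lspace[OF u(1) r]] have "f \<in> Lspace \<sigma> (ennreal r)"
    by simp
  then show ?thesis using ex by (simp add: Hardy_def)
qed

lemma Hardy_top_approx:
  assumes "f \<in> Hardy A \<sigma> \<top>" "finite F" "F \<subseteq> Lspace \<sigma> 1" "0 < \<epsilon>"
  shows "\<exists>u\<in>A. \<forall>h\<in>F. cmod (LINT x|\<sigma>. (f x - u x) * h x) < \<epsilon>"
proof -
  have "\<forall>F \<epsilon>. finite F \<and> F \<subseteq> Lspace \<sigma> 1 \<and> \<epsilon> > (0::real) \<longrightarrow>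
      (\<exists>g\<in>A. \<forall>h\<in>F. cmod (LINT x|\<sigma>. (f x - g x) * h x) < \<epsilon>)"
    using assms(1) by (simp add: Hardy_def)
  then show ?thesis using assms(2-4) by simp
qed

text \<open>Kernels are determined only almost everywhere, so membership must pass between
  representatives. For finite exponent the constant sequence \<open>f\<close> is fed to
  \<open>Hardy_closed\<close>; for infinite exponent the weak-* neighbourhoods only see
  integrals.\<close>

lemma Hardy_cong_AE:
  assumes "1 \<le> r" "f \<in> Hardy A \<sigma> r" "g \<in> borel_measurable \<sigma>" "AE x in \<sigma>. f x = g x"
  shows "g \<in> Hardy A \<sigma> r"
proof (cases r)
  case (real t)
  then have t: "0 < t" using assms(1) by (cases "t = 0") auto
  have "Lnorm \<sigma> (ennreal t) (\<lambda>x. g x - f x) = Lnorm \<sigma> (ennreal t) (\<lambda>x. 0)"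
    using assms(4) t by (intro Lnorm_cong_AE) (auto elim!: eventually_mono)
  also have "\<dots> = 0" using t by (simp add: Lnorm_def enn_Lnorm_finite)
  finally show ?thesis
    using Hardy_closed[of t "\<lambda>_. f" g] t assms(2,3) real by simp
next
  case top
  have [measurable]: "f \<in> borel_measurable \<sigma>" by (rule Hardy_measurable[OF assms(2)])
  note [measurable] = assms(3)
  have "Lnorm \<sigma> \<top> g = Lnorm \<sigma> \<top> f"
    unfolding Lnorm_def enn_Lnorm_top using assms(4)
    by (intro esssup_AE_cong) (auto elim!: eventually_mono)
  then have g: "g \<in> Lspace \<sigma> \<top>"
    using Hardy_Lspace[OF assms(2)] top by (simp add: Lspace_def)
  have eq: "(LINT x|\<sigma>. (f x - u x) * h x) = (LINT x|\<sigma>. (g x - u x) * h x)"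
    if "u \<in> A" "h \<in> borel_measurable \<sigma>" for u h
    using assms(4) that A_measurable[OF that(1)] by (intro integral_cong_AE) (auto elim!: eventually_mono)
  have "\<exists>u\<in>A. \<forall>h\<in>F. cmod (LINT x|\<sigma>. (g x - u x) * h x) < \<epsilon>"
    if F: "finite F" "F \<subseteq> Lspace \<sigma> 1" "0 < \<epsilon>" for F \<epsilon>
  proof -
    obtain u where u: "u \<in> A" "\<forall>h\<in>F. cmod (LINT x|\<sigma>. (f x - u x) * h x) < \<epsilon>"
      using Hardy_top_approx[OF _ F, of f] assms(2) top by auto
    then show ?thesis
      using eq[OF u(1)] F(2) Lspace_measurable by (intro bexI[of _ u]) fastforce+
  qed
  then show ?thesis using g top by (simp add: Hardy_def)
qed

text \<open>On a probability space norms increase with the exponent, so approximants for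
  \<open>t\<close> also approximate for \<open>r\<close>.\<close>

lemma Hardy_antimono:
  assumes "0 < r" "r \<le> t" "f \<in> Hardy A \<sigma> (ennreal t)"
  shows "f \<in> Hardy A \<sigma> (ennreal r)"
proof -
  from assms obtain g where g: "\<And>n. g n \<in> A" "(\<lambda>n. Lnorm \<sigma> (ennreal t) (\<lambda>x. f x - g n x)) \<longlonglongrightarrow> 0"
    using Hardy_approx[of t f] by (metis less_le_trans)
  have "(\<lambda>n. Lnorm \<sigma> (ennreal r) (\<lambda>x. f x - g n x)) \<longlonglongrightarrow> 0"
    using A_measurable[OF g(1)] Hardy_measurable[OF assms(3)] assms
    by (intro tendsto_0_ennreal_le[OF g(2)] Lnorm_le_exponent) auto
  then show ?thesis
    by (rule Hardy_closed[OF assms(1) A_Hardy[OF g(1) assms(1)] Hardy_measurable[OF assms(3)]])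
qed

section \<open>Linear combinations and products of Hardy functions\<close>

lemma Hardy_add:
  assumes r: "0 < r" and f: "f \<in> Hardy A \<sigma> (ennreal r)" and f': "f' \<in> Hardy A \<sigma> (ennreal r)"
  shows "(\<lambda>x. f x + f' x) \<in> Hardy A \<sigma> (ennreal r)"
proof -
  obtain g where g: "\<And>n. g n \<in> A" "(\<lambda>n. Lnorm \<sigma> (ennreal r) (\<lambda>x. f x - g n x)) \<longlonglongrightarrow> 0"
    using Hardy_approx[OF r f] by blast
  obtain g' where g': "\<And>n. g' n \<in> A" "(\<lambda>n. Lnorm \<sigma> (ennreal r) (\<lambda>x. f' x - g' n x)) \<longlonglongrightarrow> 0"
    using Hardy_approx[OF r f'] by blast
  note [measurable] = Hardy_measurable[OF f] Hardy_measurable[OF f'] A_measurable[OF g(1)] A_measurable[OF g'(1)]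
  have b: "Lnorm \<sigma> (ennreal r) (\<lambda>x. (f x + f' x) - (g n x + g' n x)) \<le> ennreal (2 * 2 powr (1 / r)) *
     (Lnorm \<sigma> (ennreal r) (\<lambda>x. f x - g n x) + Lnorm \<sigma> (ennreal r) (\<lambda>x. f' x - g' n x))" for n
    using Lnorm_add_le[OF r, of "\<lambda>x. f x - g n x" \<sigma> "\<lambda>x. f' x - g' n x"]
    by (simp add: add_diff_add)
  have "(\<lambda>n. Lnorm \<sigma> (ennreal r) (\<lambda>x. (f x + f' x) - (g n x + g' n x))) \<longlonglongrightarrow> 0"
    using tendsto_add[OF g(2) g'(2)]
    by (intro tendsto_0_ennreal_le[OF tendsto_0_ennreal_cmult b]) auto
  then show ?thesis
    by (intro Hardy_closed[OF r A_Hardy[OF A_add[OF g(1) g'(1)] r]]) auto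
qed

lemma Hardy_cmult:
  assumes r: "0 < r" and f: "f \<in> Hardy A \<sigma> (ennreal r)"
  shows "(\<lambda>x. c * f x) \<in> Hardy A \<sigma> (ennreal r)"
proof -
  obtain g where g: "\<And>n. g n \<in> A" "(\<lambda>n. Lnorm \<sigma> (ennreal r) (\<lambda>x. f x - g n x)) \<longlonglongrightarrow> 0"
    using Hardy_approx[OF r f] by blast
  note [measurable] = Hardy_measurable[OF f] A_measurable[OF g(1)]
  have "Lnorm \<sigma> (ennreal r) (\<lambda>x. c * f x - c * g n x) = ennreal (cmod c) * Lnorm \<sigma> (ennreal r) (\<lambda>x. f x - g n x)" for n
    using Lnorm_cmult[OF r, of "\<lambda>x. f x - g n x" \<sigma> c] by (simp add: right_diff_distrib)
  then have "(\<lambda>n. Lnorm \<sigma> (ennreal r) (\<lambda>x. c * f x - c * g n x)) \<longlonglongrightarrow> 0"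
    using tendsto_0_ennreal_cmult[OF g(2)] by simp
  then show ?thesis
    by (intro Hardy_closed[OF r A_Hardy[OF A_cmult[OF g(1)] r]]) auto
qed

lemma Hardy_sum:
  assumes r: "0 < r" and "\<And>i. i \<in> F \<Longrightarrow> f i \<in> Hardy A \<sigma> (ennreal r)"
  shows "(\<lambda>x. \<Sum>i\<in>F. f i x) \<in> Hardy A \<sigma> (ennreal r)"
  using assms(2)
proof (induction F rule: infinite_finite_induct)
  case (infinite F)
  \<comment> \<open>A sum over an infinite set is 0 by convention, and the zero function is 0 times
    the unit of \<open>A\<close>.\<close>
  show ?case using A_Hardy[OF A_cmult[OF A_one, of 0] r] infinite by simp
next
  case empty
  show ?case using A_Hardy[OF A_cmult[OF A_one, of 0] r] by simp
next
  case (insert i F)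
  then show ?case using Hardy_add[OF r, of "f i" "\<lambda>x. \<Sum>i\<in>F. f i x"] by simp
qed

text \<open>The approximants are returned along with the membership, since \<open>Hval_mult\<close>
  needs all three limits for one and the same pair of sequences.\<close>

lemma Hardy_mult:
  assumes pos: "0 < s" "0 < p" "0 < q" and spq: "1 / s = 1 / p + 1 / q"
    and f: "f \<in> Hardy A \<sigma> (ennreal p)" and h: "h \<in> Hardy A \<sigma> (ennreal q)"
  obtains u v where "\<And>n. u n \<in> A" "\<And>n. v n \<in> A"
    "(\<lambda>n. Lnorm \<sigma> (ennreal p) (\<lambda>x. f x - u n x)) \<longlonglongrightarrow> 0"
    "(\<lambda>n. Lnorm \<sigma> (ennreal q) (\<lambda>x. h x - v n x)) \<longlonglongrightarrow> 0"
    "(\<lambda>n. Lnorm \<sigma> (ennreal s) (\<lambda>x. f x * h x - u n x * v n x)) \<longlonglongrightarrow> 0"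
    "(\<lambda>x. f x * h x) \<in> Hardy A \<sigma> (ennreal s)"
proof -
  obtain u where u: "\<And>n. u n \<in> A" "(\<lambda>n. Lnorm \<sigma> (ennreal p) (\<lambda>x. f x - u n x)) \<longlonglongrightarrow> 0"
    using Hardy_approx[OF pos(2) f] by blast
  obtain v where v: "\<And>n. v n \<in> A" "(\<lambda>n. Lnorm \<sigma> (ennreal q) (\<lambda>x. h x - v n x)) \<longlonglongrightarrow> 0"
    using Hardy_approx[OF pos(3) h] by blast
  note [measurable] = Hardy_measurable[OF f] Hardy_measurable[OF h] A_measurable[OF u(1)] A_measurable[OF v(1)]
  define K where "K = ennreal (2 * 2 powr (1 / s))"
  define L where "L = ennreal (2 * 2 powr (1 / q))"
  have KL: "K < \<top>" "L < \<top>" by (simp_all add: K_def L_def)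
  define a where "a n = Lnorm \<sigma> (ennreal p) (\<lambda>x. f x - u n x)" for n
  define b where "b n = Lnorm \<sigma> (ennreal q) (\<lambda>x. h x - v n x)" for n
  define N where "N = Lnorm \<sigma> (ennreal q) h"
  define P where "P = Lnorm \<sigma> (ennreal p) f"
  have NP: "N < \<top>" "P < \<top>"
    using Hardy_Lspace[OF f] Hardy_Lspace[OF h] by (auto simp: Lspace_def N_def P_def)
  \<comment> \<open>Writing \<open>v n\<close> as \<open>h + (v n - h)\<close> bounds its norm by
    that of \<open>h\<close> and the error \<open>b n\<close>.\<close>
  have vn: "Lnorm \<sigma> (ennreal q) (v n) \<le> L * (N + b n)" for n
    using Lnorm_add_le[OF pos(3), of h \<sigma> "\<lambda>x. v n x - h x"]
    by (simp add: L_def N_def b_def Lnorm_minus_commute)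
  have bound: "Lnorm \<sigma> (ennreal s) (\<lambda>x. f x * h x - u n x * v n x) \<le> K * (a n * (L * (N + b n)) + P * b n)" for n
  proof -
    \<comment> \<open>Splitting the error as (f - u n) v n + f (h - v n) leaves one small factor in
      each term, so Hoelder applies to both.\<close>
    have "Lnorm \<sigma> (ennreal s) (\<lambda>x. f x * h x - u n x * v n x)
        = Lnorm \<sigma> (ennreal s) (\<lambda>x. (f x - u n x) * v n x + f x * (h x - v n x))"
      by (simp add: algebra_simps)
    also have "\<dots> \<le> K * (Lnorm \<sigma> (ennreal s) (\<lambda>x. (f x - u n x) * v n x)
         + Lnorm \<sigma> (ennreal s) (\<lambda>x. f x * (h x - v n x)))"
      unfolding K_def by (intro Lnorm_add_le pos) auto
    also have "\<dots> \<le> K * (a n * Lnorm \<sigma> (ennreal q) (v n) + P * b n)"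
      unfolding a_def b_def P_def by (intro mult_left_mono add_mono Lnorm_mult_le pos spq) auto
    also have "\<dots> \<le> K * (a n * (L * (N + b n)) + P * b n)"
      by (intro mult_left_mono add_right_mono vn) auto
    finally show ?thesis .
  qed
  have ab: "a \<longlonglongrightarrow> 0" "b \<longlonglongrightarrow> 0" using u v by (simp_all add: a_def[abs_def] b_def[abs_def])
  have "(\<lambda>n. a n * (L * (N + b n))) \<longlonglongrightarrow> 0 * (L * (N + 0))"
    using KL NP by (intro ab tendsto_mult_ennreal ennreal_tendsto_cmult tendsto_intros)
       (auto simp: ennreal_mult_eq_top_iff)
  moreover have "(\<lambda>n. P * b n) \<longlonglongrightarrow> 0" by (intro tendsto_0_ennreal_cmult ab NP)
  ultimately have "(\<lambda>n. a n * (L * (N + b n)) + P * b n) \<longlonglongrightarrow> 0"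
    using tendsto_add by fastforce
  then have lim: "(\<lambda>n. Lnorm \<sigma> (ennreal s) (\<lambda>x. f x * h x - u n x * v n x)) \<longlonglongrightarrow> 0"
    by (intro tendsto_0_ennreal_le[OF tendsto_0_ennreal_cmult bound] KL)
  then have "(\<lambda>x. f x * h x) \<in> Hardy A \<sigma> (ennreal s)"
    by (intro Hardy_closed[OF pos(1) A_Hardy[OF A_mult[OF u(1) v(1)] pos(1)]]) auto
  with u(1) v(1) u(2) v(2) lim show ?thesis by (rule that)
qed

end

subsection \<open>Reproducing kernels\<close>

text \<open>For finite \<open>t\<close>, approximate \<open>m\<close> by \<open>A\<close> in the
  2-norm. For infinite \<open>t\<close>, the weak-* closure is tested against the conjugate of
  \<open>d\<close> alone, which is integrable because \<open>d\<close> is square integrable.\<close>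

lemma (in hardy_setting) Hardy_orthogonal:
  assumes t: "2 \<le> t" and m: "m \<in> Hardy A \<sigma> t" and d: "d \<in> Lspace \<sigma> 2"
    and orth: "\<And>f. f \<in> A \<Longrightarrow> pairing \<sigma> f d = 0"
  shows "pairing \<sigma> m d = 0"
proof (cases t)
  case (real u)
  have d': "d \<in> Lspace \<sigma> (conj_exp (ennreal 2))" using d by (simp add: conj_exp_2)
  from real t have "2 \<le> u" by (simp add: ennreal_le_iff2 flip: ennreal_numeral)
  then have m2: "m \<in> Hardy A \<sigma> (ennreal 2)"
    using Hardy_antimono[of 2 u m] m real by simp
  obtain g where g: "\<And>n. g n \<in> A" "(\<lambda>n. Lnorm \<sigma> (ennreal 2) (\<lambda>x. m x - g n x)) \<longlonglongrightarrow> 0"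
    using Hardy_approx[OF _ m2] by auto
  have "(\<lambda>n. pairing \<sigma> (g n) d) \<longlonglongrightarrow> pairing \<sigma> m d"
    by (rule pairing_tendsto[OF _ A_Lspace[OF g(1)] Hardy_Lspace[OF m2] d' g(2)]) auto
  then show ?thesis
    by (simp add: orth[OF g(1)] LIMSEQ_const_iff)
next
  case top
  have d': "d \<in> Lspace \<sigma> (conj_exp (ennreal 2))" using d by (simp add: conj_exp_2)
  have m2: "m \<in> Lspace \<sigma> (ennreal 2)"
    using Lspace_antimono[of 2 \<top> m] Hardy_Lspace[OF m] top by simp
  have "d \<in> Lspace \<sigma> 1"
    using Lspace_antimono[of 1 2 d] d by simp
  then have d1: "{\<lambda>x. cnj (d x)} \<subseteq> Lspace \<sigma> 1"
    by (auto simp: Lspace_def Lnorm_def)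
  have "cmod (pairing \<sigma> m d) < \<epsilon>" if pos: "0 < \<epsilon>" for \<epsilon>
  proof -
    obtain u where u: "u \<in> A" "\<forall>h\<in>{\<lambda>x. cnj (d x)}. cmod (LINT x|\<sigma>. (m x - u x) * h x) < \<epsilon>"
      using Hardy_top_approx[OF _ _ d1 pos, of m] m top by auto
    then have "cmod (pairing \<sigma> (\<lambda>x. m x - u x) d) < \<epsilon>"
      by (simp add: pairing_def)
    then show ?thesis
      using pairing_diff[OF _ m2 A_Lspace[OF u(1)] d'] orth[OF u(1)] by simp
  qed
  then show ?thesis
    by (metis less_irrefl zero_less_norm_iff)
qed

text \<open>The difference \<open>d\<close> is orthogonal to \<open>A\<close>, hence to
  \<open>k\<close> and to \<open>k'\<close>, hence to itself. Two exponents are allowed so that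
  kernels found in different Hardy spaces can be identified.\<close>

lemma (in hardy_setting) kernel_unique:
  assumes "2 \<le> t" "k \<in> Hardy A \<sigma> t" "2 \<le> t'" "k' \<in> Hardy A \<sigma> t'"
    and eq: "\<And>f. f \<in> A \<Longrightarrow> pairing \<sigma> f k = pairing \<sigma> f k'"
  shows "AE x in \<sigma>. k x = k' x"
proof -
  define d where "d = (\<lambda>x. k x - k' x)"
  have k: "k \<in> Lspace \<sigma> (ennreal 2)" "k' \<in> Lspace \<sigma> (ennreal 2)"
    using assms by (auto intro: Lspace_antimono[of 2] Hardy_Lspace simp del: ennreal_numeral simp flip: ennreal_numeral)
  then have d: "d \<in> Lspace \<sigma> (ennreal 2)"
    unfolding d_def by (intro Lspace_diff) auto
  \<comment> \<open>\<open>pairing_diff\<close> splits the first slot; conjugate symmetry carries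
    this over to the second.\<close>
  have cnj_pairing: "pairing \<sigma> g f = cnj (pairing \<sigma> f g)" for f g
  proof -
    have "cnj (pairing \<sigma> f g) = (LINT x|\<sigma>. cnj (f x * cnj (g x)))"
      unfolding pairing_def by (rule Bochner_Integration.integral_cnj[symmetric])
    then show ?thesis by (simp add: pairing_def mult.commute)
  qed
  have orth: "pairing \<sigma> f d = 0" if "f \<in> A" for f
  proof -
    have "pairing \<sigma> d f = pairing \<sigma> k f - pairing \<sigma> k' f"
      unfolding d_def using A_Lspace[OF that, of 2] by (intro pairing_diff[of 2] k) (auto simp: conj_exp_2)
    also have "\<dots> = 0"
      using eq[OF that] by (simp add: cnj_pairing[of _ f])
    finally show ?thesis by (simp add: cnj_pairing[of d f])
  qed
  have "pairing \<sigma> d d = pairing \<sigma> k d - pairing \<sigma> k' d"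
    using k d by (subst (1) d_def, intro pairing_diff[of 2]) (auto simp: conj_exp_2)
  also have "\<dots> = 0"
    using Hardy_orthogonal[OF assms(1,2) _ orth] Hardy_orthogonal[OF assms(3,4) _ orth] d by simp
  finally have "Lnorm \<sigma> (ennreal 2) d = 0"
    using Lnorm_2_sq_eq_pairing(1)[of d \<sigma>] d by simp
  from Lnorm_eq_0[OF _ _ this] d show ?thesis
    by (auto simp: d_def Lspace_measurable)
qed

text \<open>Shows that the choice in \<open>kernel\<close> has a witness, namely the reproducing
  function \<open>k\<close> in the q-Hardy space. If the conjugate of \<open>r\<close> is at most
  \<open>q\<close>, inclusion of Hardy spaces puts \<open>k\<close> where it should be; otherwise
  that conjugate is at least 2 and uniqueness identifies \<open>k\<close> with the kernel found
  there.\<close>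

lemma (in hardy_setting) kernel_spec:
  assumes q: "2 \<le> q" and a: "a \<in> spectrum A \<sigma> (conj_exp (ennreal q))"
  shows "f \<in> A \<Longrightarrow> a f = pairing \<sigma> f (kernel A \<sigma> a)"
    and "1 \<le> r \<Longrightarrow> a \<in> spectrum A \<sigma> r \<Longrightarrow> kernel A \<sigma> a \<in> Hardy A \<sigma> (conj_exp r)"
proof -
  from a q obtain k where k: "k \<in> Hardy A \<sigma> (ennreal q)" "\<forall>f\<in>A. a f = pairing \<sigma> f k"
    by (auto simp: spectrum_def conj_exp_conj_exp)
  have "k \<in> Hardy A \<sigma> (conj_exp r)" if r: "1 \<le> r" "a \<in> spectrum A \<sigma> r" for r
  proof -
    obtain k' where k': "k' \<in> Hardy A \<sigma> (conj_exp r)" "\<forall>f\<in>A. a f = pairing \<sigma> f k'"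
      using r by (auto simp: spectrum_def)
    show ?thesis
    proof (cases "conj_exp r \<le> ennreal q")
      case True
      then obtain u where u: "conj_exp r = ennreal u" "0 \<le> u"
        by (metis ennreal_cases ennreal_less_top leD)
      then have "1 \<le> u" using conj_exp_ge_1[of r] by simp
      then show ?thesis using Hardy_antimono[of u q k] k(1) True q u by simp
    next
      case False
      have "(2::ennreal) \<le> ennreal q" using q ennreal_leI by fastforce
      moreover from this have "2 \<le> conj_exp r" using False by (meson order_trans linear)
      ultimately have "AE x in \<sigma>. k' x = k x"
        using False k k' by (intro kernel_unique[of "conj_exp r" k' "ennreal q" k]) auto
      then show ?thesis
        using Hardy_cong_AE[OF conj_exp_ge_1 k'(1) Hardy_measurable[OF k(1)]] by blast
    qed
  qed
  with k(2) have "\<exists>k. (\<forall>f\<in>A. a f = pairing \<sigma> f k) \<and>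
     (\<forall>r\<ge>1. a \<in> spectrum A \<sigma> r \<longrightarrow> k \<in> Hardy A \<sigma> (conj_exp r))" by blast
  from someI_ex[OF this] show "f \<in> A \<Longrightarrow> a f = pairing \<sigma> f (kernel A \<sigma> a)"
    and "1 \<le> r \<Longrightarrow> a \<in> spectrum A \<sigma> r \<Longrightarrow> kernel A \<sigma> a \<in> Hardy A \<sigma> (conj_exp r)"
    unfolding kernel_def by blast+
qed

lemma (in hardy_setting) gelfand_spectrum_one:
  assumes "a \<in> gelfand_spectrum A"
  shows "a (\<lambda>x. 1) = 1"
proof -
  obtain f where f: "f \<in> A" "a f \<noteq> 0" using assms by (auto simp: gelfand_spectrum_def)
  have "a (\<lambda>x. f x * 1) = a f * a (\<lambda>x. 1)"
    using assms f(1) A_one by (simp only: gelfand_spectrum_def mem_Collect_eq)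
  with f show ?thesis by simp
qed

text \<open>\<open>b\<close> is multiplicative on the approximants from \<open>A\<close>, and
  pairing with \<open>k\<close> is continuous in the s-norm, so the identity survives the limit.
  Thus a zero of one factor at \<open>b\<close> is a zero of the product.\<close>

lemma (in hardy_setting) Hval_mult:
  assumes s: "1 \<le> s" and pq: "0 < p" "0 < q" and spq: "1 / s = 1 / p + 1 / q"
    and f: "f \<in> Hardy A \<sigma> (ennreal p)" and h: "h \<in> Hardy A \<sigma> (ennreal q)"
    and b: "b \<in> gelfand_spectrum A" "\<And>f. f \<in> A \<Longrightarrow> b f = pairing \<sigma> f k"
    and k: "k \<in> Lspace \<sigma> (conj_exp (ennreal s))"
  shows "pairing \<sigma> (\<lambda>x. f x * h x) k = pairing \<sigma> f k * pairing \<sigma> h k"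
proof -
  have pos: "0 < s" using s by simp
  have le: "s \<le> p" "s \<le> q"
    using spq pq pos by (smt (verit) divide_pos_pos frac_less2)+
  obtain u v where u: "\<And>n. u n \<in> A" and v: "\<And>n. v n \<in> A"
    and lu: "(\<lambda>n. Lnorm \<sigma> (ennreal p) (\<lambda>x. f x - u n x)) \<longlonglongrightarrow> 0"
    and lv: "(\<lambda>n. Lnorm \<sigma> (ennreal q) (\<lambda>x. h x - v n x)) \<longlonglongrightarrow> 0"
    and luv: "(\<lambda>n. Lnorm \<sigma> (ennreal s) (\<lambda>x. f x * h x - u n x * v n x)) \<longlonglongrightarrow> 0"
    and fh: "(\<lambda>x. f x * h x) \<in> Hardy A \<sigma> (ennreal s)"
    using Hardy_mult[OF pos pq spq f h] by blast
  note [measurable] = Hardy_measurable[OF f] Hardy_measurable[OF h] A_measurable[OF u] A_measurable[OF v]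
  \<comment> \<open>\<open>k\<close> acts continuously on the s-norm, so the convergence in the p-
    and q-norms is first weakened to it.\<close>
  have lu': "(\<lambda>n. Lnorm \<sigma> (ennreal s) (\<lambda>x. f x - u n x)) \<longlonglongrightarrow> 0"
    using le pos by (intro tendsto_0_ennreal_le[OF lu] Lnorm_le_exponent) auto
  have lv': "(\<lambda>n. Lnorm \<sigma> (ennreal s) (\<lambda>x. h x - v n x)) \<longlonglongrightarrow> 0"
    using le pos by (intro tendsto_0_ennreal_le[OF lv] Lnorm_le_exponent) auto
  have 1: "(\<lambda>n. pairing \<sigma> (u n) k) \<longlonglongrightarrow> pairing \<sigma> f k"
    by (intro pairing_tendsto[OF s A_Lspace[OF u pos] _ k lu'] Hardy_Lspace Hardy_antimono[OF pos le(1) f])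
  have 2: "(\<lambda>n. pairing \<sigma> (v n) k) \<longlonglongrightarrow> pairing \<sigma> h k"
    by (intro pairing_tendsto[OF s A_Lspace[OF v pos] _ k lv'] Hardy_Lspace Hardy_antimono[OF pos le(2) h])
  have 3: "(\<lambda>n. pairing \<sigma> (\<lambda>x. u n x * v n x) k) \<longlonglongrightarrow> pairing \<sigma> (\<lambda>x. f x * h x) k"
    by (intro pairing_tendsto[OF s A_Lspace[OF A_mult[OF u v] pos] _ k luv] Hardy_Lspace fh)
  have "b (\<lambda>x. u n x * v n x) = b (u n) * b (v n)" for n
    using b(1) u[of n] v[of n] by (simp only: gelfand_spectrum_def mem_Collect_eq)
  then have eq: "pairing \<sigma> (\<lambda>x. u n x * v n x) k = pairing \<sigma> (u n) k * pairing \<sigma> (v n) k" for n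
    using b(2)[OF u[of n]] b(2)[OF v[of n]] b(2)[OF A_mult[OF u[of n] v[of n]]] by simp
  show ?thesis
    by (rule LIMSEQ_unique[OF 3]) (unfold eq, intro tendsto_mult 1 2)
qed

subsection \<open>Sums over the sequence\<close>

text \<open>Turns unordered sums into integrals, which opens them to Tonelli and Hoelder. Along an
  enumeration of \<open>S\<close>, every finite subset sits inside an initial segment.\<close>

lemma infsum_eq_nn_integral_count_space:
  fixes f :: "'i \<Rightarrow> ennreal"
  assumes "countable S"
  shows "infsum f S = (\<integral>\<^sup>+ a. f a \<partial>count_space S)"
proof (cases "finite S")
  case True
  then show ?thesis by (simp add: nn_integral_count_space_finite)
next
  case False
  then have inj: "inj_on (from_nat_into S) UNIV" and im: "range (from_nat_into S) = S"
    using assms bij_betw_from_nat_into[of S] by (auto simp: bij_betw_def)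
  have "infsum f S = (SUP F\<in>{F. finite F \<and> F \<subseteq> S}. sum f F)"
    by (rule nonneg_infsum_complete) simp
  also have "\<dots> = (SUP n. \<Sum>i<n. f (from_nat_into S i))"
  proof (rule antisym)
    show "(SUP F\<in>{F. finite F \<and> F \<subseteq> S}. sum f F) \<le> (SUP n. \<Sum>i<n. f (from_nat_into S i))"
    proof (rule SUP_least)
      fix F assume "F \<in> {F. finite F \<and> F \<subseteq> S}"
      then have F: "finite F" "F \<subseteq> from_nat_into S ` UNIV" by (auto simp: im)
      then obtain C where C: "finite C" "F = from_nat_into S ` C"
        by (metis finite_subset_image)
      then obtain n where "C \<subseteq> {..<n}" by (metis finite_nat_iff_bounded)
      then have "sum f F \<le> (\<Sum>i<n. f (from_nat_into S i))"
        unfolding C(2) using inj by (subst sum.reindex) (auto intro: sum_mono2 inj_on_subset)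
      then show "sum f F \<le> (SUP n. \<Sum>i<n. f (from_nat_into S i))"
        by (rule SUP_upper2[OF UNIV_I])
    qed
    show "(SUP n. \<Sum>i<n. f (from_nat_into S i)) \<le> (SUP F\<in>{F. finite F \<and> F \<subseteq> S}. sum f F)"
    proof (rule SUP_least)
      fix n :: nat
      have "(\<Sum>i<n. f (from_nat_into S i)) = sum f (from_nat_into S ` {..<n})"
        using inj by (subst sum.reindex) (auto intro: inj_on_subset)
      also have "\<dots> \<le> (SUP F\<in>{F. finite F \<and> F \<subseteq> S}. sum f F)"
        using im by (intro SUP_upper) auto
      finally show "(\<Sum>i<n. f (from_nat_into S i)) \<le> (SUP F\<in>{F. finite F \<and> F \<subseteq> S}. sum f F)" .
    qed
  qed
  also have "\<dots> = (\<Sum>i. f (from_nat_into S i))"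
    by (rule suminf_eq_SUP[symmetric])
  also have "\<dots> = (\<integral>\<^sup>+ i. f (from_nat_into S i) \<partial>count_space UNIV)"
    by (rule nn_integral_count_space_nat[symmetric])
  also have "\<dots> = (\<integral>\<^sup>+ a. f a \<partial>count_space S)"
    using assms False by (intro nn_integral_bij_count_space bij_betw_from_nat_into)
  finally show ?thesis .
qed

lemma measurable_pair_count_space:
  assumes "countable S" "\<And>a. a \<in> S \<Longrightarrow> (\<lambda>x. f x a) \<in> measurable M K"
  shows "(\<lambda>(x, a). f x a) \<in> measurable (M \<Otimes>\<^sub>M count_space S) K"
proof -
  have "(\<lambda>p. f (snd p) (fst p)) \<in> measurable (count_space S \<Otimes>\<^sub>M M) K"
    by (rule measurable_pair_measure_countable1[OF assms(1)]) (simp add: assms(2))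
  from measurable_compose[OF measurable_pair_swap' this] show ?thesis
    by (simp add: split_beta' comp_def)
qed

lemma borel_measurable_nn_integral_count_space:
  assumes "countable S" "\<And>a. a \<in> S \<Longrightarrow> (\<lambda>x. f x a) \<in> borel_measurable M"
  shows "(\<lambda>x. \<integral>\<^sup>+ a. f x a \<partial>count_space S) \<in> borel_measurable M"
  by (rule sigma_finite_measure.borel_measurable_nn_integral
      [OF sigma_finite_measure_count_space_countable measurable_pair_count_space]) (use assms in auto)

lemma borel_measurable_lebesgue_integral_count_space:
  fixes f :: "'a \<Rightarrow> 'i \<Rightarrow> complex"
  assumes "countable S" "\<And>a. a \<in> S \<Longrightarrow> (\<lambda>x. f x a) \<in> borel_measurable M"
  shows "(\<lambda>x. LINT a|count_space S. f x a) \<in> borel_measurable M"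
  by (rule sigma_finite_measure.borel_measurable_lebesgue_integral
      [OF sigma_finite_measure_count_space_countable measurable_pair_count_space]) (use assms in auto)

text \<open>Every value of \<open>f\<close> is at most its r-norm N, so the t-th power of
  \<open>f\<close> is at most N^(t - r) times the r-th power, and this sums to N^t. It is applied to
  the exponents \<open>p\<close> and 2.\<close>

lemma enn_Lnorm_count_space_antimono:
  assumes r: "0 < r" "r \<le> t"
  shows "enn_Lnorm (count_space S) (ennreal t) f \<le> enn_Lnorm (count_space S) (ennreal r) f"
proof -
  define N where "N = enn_Lnorm (count_space S) (ennreal r) f"
  have Nr: "(\<integral>\<^sup>+ a. epowr (f a) r \<partial>count_space S) = epowr N r"
    using r by (simp add: N_def enn_Lnorm_finite epowr_epowr)
  have le: "f a \<le> N" if "a \<in> S" for a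
  proof -
    have "epowr (f a) r \<le> epowr N r"
      unfolding Nr[symmetric] using that by (rule nn_integral_ge_point)
    from epowr_mono[OF this, of "1 / r"] show ?thesis using r by (simp add: epowr_epowr)
  qed
  have "(\<integral>\<^sup>+ a. epowr (f a) t \<partial>count_space S) \<le> (\<integral>\<^sup>+ a. epowr N (t - r) * epowr (f a) r \<partial>count_space S)"
  proof (rule nn_integral_mono)
    fix a assume "a \<in> space (count_space S)"
    then have "epowr (f a) (t - r) \<le> epowr N (t - r)" using r le by (intro epowr_mono) auto
    from mult_right_mono[OF this, of "epowr (f a) r"]
    show "epowr (f a) t \<le> epowr N (t - r) * epowr (f a) r"
      by (simp flip: epowr_add_exp)
  qed
  also have "\<dots> = epowr N t"
    by (simp add: nn_integral_cmult Nr flip: epowr_add_exp)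
  finally have "epowr (\<integral>\<^sup>+ a. epowr (f a) t \<partial>count_space S) (1 / t) \<le> epowr (epowr N t) (1 / t)"
    using r by (intro epowr_mono) auto
  then show ?thesis
    using r by (simp add: enn_Lnorm_finite epowr_epowr N_def)
qed

lemma nn_integral_lspace:
  assumes "countable S" "\<nu> \<in> lspace S s" "0 < s"
  shows "(\<integral>\<^sup>+ a. epowr (ennreal (cmod (\<nu> a))) s \<partial>count_space S) = epowr (ennreal (lnorm S s \<nu>)) s"
proof -
  have sum: "(\<lambda>a. cmod (\<nu> a) powr s) summable_on S" using assms(2) by (simp add: lspace_def)
  have nonneg: "0 \<le> (\<Sum>\<^sub>\<infinity>a\<in>S. cmod (\<nu> a) powr s)" by (rule infsum_nonneg) simp
  have "(\<integral>\<^sup>+ a. epowr (ennreal (cmod (\<nu> a))) s \<partial>count_space S)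
      = (\<Sum>\<^sub>\<infinity>a\<in>S. ennreal (cmod (\<nu> a) powr s))"
    by (simp add: infsum_eq_nn_integral_count_space[OF assms(1)] epowr_ennreal)
  \<comment> \<open>The supremum over finite subsets is the common form of the extended sum and of
    the real one.\<close>
  also have "\<dots> = (SUP F\<in>{F. finite F \<and> F \<subseteq> S}. ennreal (\<Sum>a\<in>F. cmod (\<nu> a) powr s))"
    by (subst nonneg_infsum_complete) auto
  also have "\<dots> = ennreal (\<Sum>\<^sub>\<infinity>a\<in>S. cmod (\<nu> a) powr s)"
    by (rule infsum_nonneg_is_SUPREMUM_ennreal[symmetric, OF sum]) simp
  also have "\<dots> = epowr (ennreal (lnorm S s \<nu>)) s"
    using assms(3) nonneg by (simp add: lnorm_def epowr_ennreal powr_powr)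
  finally show ?thesis .
qed

section \<open>Norm estimate for series of products\<close>

lemma lnorm_nonneg: "0 \<le> lnorm S s \<nu>"
  by (simp add: lnorm_def)

text \<open>The factorization \<open>|\<nu>| = |\<nu>| powr (s / p) * |\<nu>| powr (s / q)\<close> splits a sequence of
  \<open>\<ell>\<^sup>s\<close> between \<open>\<ell>\<^sup>p\<close> and \<open>\<ell>\<^sup>q\<close>.\<close>

lemma Lnorm_weighted_sum_le:
  fixes R G :: "'i \<Rightarrow> 'x \<Rightarrow> complex"
  assumes cS: "countable S" and pos: "0 < s" "0 < p" "p \<le> 2" "0 < q" and spq: "1 / s = 1 / p + 1 / q"
    and [measurable]: "\<And>a. a \<in> S \<Longrightarrow> R a \<in> borel_measurable M" "\<And>a. a \<in> S \<Longrightarrow> G a \<in> borel_measurable M"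
    and Rb: "\<And>a. a \<in> S \<Longrightarrow> Lnorm M (ennreal p) (R a) \<le> R0" and D: "0 \<le> D"
    and carl: "\<And>\<mu>. \<mu> \<in> lspace S q \<Longrightarrow> enn_Lnorm M (ennreal (q / 2))
          (\<lambda>x. \<Sum>\<^sub>\<infinity>a\<in>S. ennreal ((cmod (\<mu> a))\<^sup>2 * (cmod (G a x))\<^sup>2)) \<le> ennreal (D * (lnorm S q \<mu>)\<^sup>2)"
    and \<nu>: "\<nu> \<in> lspace S s"
  shows "enn_Lnorm M (ennreal s) (\<lambda>x. \<integral>\<^sup>+ a. ennreal (cmod (\<nu> a * (R a x * G a x))) \<partial>count_space S)
    \<le> R0 * ennreal (sqrt D) * ennreal (lnorm S s \<nu>)"
proof -
  define L where "L = ennreal (lnorm S s \<nu>)"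
  define u where "u a = ennreal (cmod (\<nu> a))" for a
  \<comment> \<open>The exponent makes |\<mu>|^q equal to |\<nu>|^s, so \<mu> is admissible in the
    weak Carleson condition and its norm is that of \<nu> to the power s / q.\<close>
  define \<mu> where "\<mu> a = complex_of_real (cmod (\<nu> a) powr (s / q))" for a
  define v where "v a = epowr (u a) (s / p)" for a
  define r where "r a x = ennreal (cmod (R a x))" for a x
  define g where "g a x = ennreal (cmod (\<mu> a)) * ennreal (cmod (G a x))" for a x
  have s1: "s / p + s / q = 1"
  proof -
    have "s * (1 / s) = s / p + s / q" unfolding spq by (simp add: field_simps)
    then show ?thesis using pos by simp
  qed
  have [measurable]: "r a \<in> borel_measurable M" "g a \<in> borel_measurable M" if "a \<in> S" for a
    using that unfolding r_def[abs_def] g_def[abs_def] by auto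
  have L: "(\<integral>\<^sup>+ a. epowr (u a) s \<partial>count_space S) = epowr L s"
    unfolding u_def L_def by (rule nn_integral_lspace[OF cS \<nu> pos(1)])
  have \<mu>u: "ennreal (cmod (\<mu> a)) = epowr (u a) (s / q)" for a
    by (simp add: \<mu>_def u_def epowr_ennreal)
  have \<mu>: "\<mu> \<in> lspace S q"
    using \<nu> pos by (auto simp: lspace_def \<mu>_def powr_powr)
  have \<mu>L: "ennreal (lnorm S q \<mu>) = epowr L (s / q)"
    using pos by (simp add: L_def lnorm_def \<mu>_def powr_powr epowr_ennreal)
  have split: "u a = v a * epowr (u a) (s / q)" for a
    by (simp add: v_def s1 flip: epowr_add_exp)
  define V where "V x = enn_Lnorm (count_space S) (ennreal p) (\<lambda>a. v a * r a x)" for x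
  define W where "W x = enn_Lnorm (count_space S) (ennreal 2) (\<lambda>a. g a x)" for x
  have [measurable]: "V \<in> borel_measurable M" "W \<in> borel_measurable M"
    unfolding V_def[abs_def] W_def[abs_def] using pos
    by (auto simp: enn_Lnorm_finite simp del: ennreal_numeral intro!: borel_measurable_epowr borel_measurable_nn_integral_count_space cS)
  \<comment> \<open>Cauchy--Schwarz over \<open>S\<close> produces the 2-norm of the sequence of
    \<open>v a * r a x\<close>; since \<open>p \<le> 2\<close>, its p-norm \<open>V x\<close> is
    larger.\<close>
  have pointwise: "(\<integral>\<^sup>+ a. ennreal (cmod (\<nu> a * (R a x * G a x))) \<partial>count_space S) \<le> V x * W x" for x
  proof -
    have "ennreal (cmod (\<nu> a * (R a x * G a x))) = (v a * r a x) * g a x" for a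
    proof -
      have "ennreal (cmod (\<nu> a * (R a x * G a x))) = u a * (r a x * ennreal (cmod (G a x)))"
        by (simp add: norm_mult ennreal_mult u_def r_def)
      also have "\<dots> = (v a * r a x) * g a x"
        unfolding g_def \<mu>u by (subst split) (simp only: ac_simps)
      finally show ?thesis .
    qed
    then have "(\<integral>\<^sup>+ a. ennreal (cmod (\<nu> a * (R a x * G a x))) \<partial>count_space S)
        = (\<integral>\<^sup>+ a. (v a * r a x) * g a x \<partial>count_space S)" by simp
    also have "\<dots> \<le> enn_Lnorm (count_space S) (ennreal 2) (\<lambda>a. v a * r a x) * W x"
      unfolding W_def by (intro hoelder_1) auto
    also have "\<dots> \<le> V x * W x"
      unfolding V_def using pos by (intro mult_right_mono enn_Lnorm_count_space_antimono) auto
    finally show ?thesis .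
  qed
  \<comment> \<open>After raising to the power \<open>p\<close>, Tonelli exchanges sum and integral.
    The p-th power of \<open>v a\<close> is |\<nu> a|^s, and the inner integrals are bounded
    uniformly by the p-th power of \<open>R0\<close>.\<close>
  have "enn_Lnorm M (ennreal p) V \<le> epowr (epowr R0 p * epowr L s) (1 / p)"
  proof -
    have rp: "(\<integral>\<^sup>+ x. epowr (r a x) p \<partial>M) \<le> epowr R0 p" if "a \<in> S" for a
      using epowr_mono[OF Rb[OF that], of p] pos by (simp add: Lnorm_def enn_Lnorm_finite epowr_epowr r_def)
    have "(\<integral>\<^sup>+ x. epowr (V x) p \<partial>M) = (\<integral>\<^sup>+ x. \<integral>\<^sup>+ a. epowr (v a * r a x) p \<partial>count_space S \<partial>M)"
      using pos by (simp add: V_def enn_Lnorm_finite epowr_epowr)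
    also have "\<dots> = (\<integral>\<^sup>+ a. \<integral>\<^sup>+ x. epowr (v a * r a x) p \<partial>M \<partial>count_space S)"
      by (rule nn_integral_count_space_nn_integral[OF cS]) measurable
    also have "\<dots> = (\<integral>\<^sup>+ a. epowr (u a) s * (\<integral>\<^sup>+ x. epowr (r a x) p \<partial>M) \<partial>count_space S)"
      using pos by (intro nn_integral_cong) (simp add: epowr_mult nn_integral_cmult v_def epowr_epowr)
    also have "\<dots> \<le> (\<integral>\<^sup>+ a. epowr (u a) s * epowr R0 p \<partial>count_space S)"
      by (intro nn_integral_mono mult_left_mono rp) auto
    also have "\<dots> = epowr R0 p * epowr L s"
      by (subst nn_integral_multc) (simp_all add: L mult.commute)
    finally show ?thesis using pos by (simp add: enn_Lnorm_finite epowr_mono)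
  qed
  then have V: "enn_Lnorm M (ennreal p) V \<le> R0 * epowr L (s / p)"
    using pos by (simp add: epowr_mult epowr_epowr)
  \<comment> \<open>The square of \<open>W\<close> is the sum \<open>Q\<close> of the weak Carleson
    condition, so the q-norm of \<open>W\<close> is the square root of the (q / 2)-norm of
    \<open>Q\<close>.\<close>
  have W: "enn_Lnorm M (ennreal q) W \<le> ennreal (sqrt D) * epowr L (s / q)"
  proof -
    define Q where "Q x = (\<Sum>\<^sub>\<infinity>a\<in>S. ennreal ((cmod (\<mu> a))\<^sup>2 * (cmod (G a x))\<^sup>2))" for x
    have "W x = epowr (Q x) (1 / 2)" for x
      unfolding W_def Q_def infsum_eq_nn_integral_count_space[OF cS]
      by (subst enn_Lnorm_finite)
        (auto simp: g_def epowr_2 power_mult_distrib ennreal_power ennreal_mult simp del: ennreal_numeral)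
    then have "W = (\<lambda>x. epowr (Q x) (1 / 2))"
      by (rule ext)
    then have "enn_Lnorm M (ennreal q) W = enn_Lnorm M (ennreal q) (\<lambda>x. epowr (Q x) (1 / 2))"
      by (simp only:)
    also have "\<dots> = epowr (enn_Lnorm M (ennreal (q / 2)) Q) (1 / 2)"
      using enn_Lnorm_epowr[of q "1 / 2" M Q] pos by simp
    also have "\<dots> \<le> epowr (ennreal (D * (lnorm S q \<mu>)\<^sup>2)) (1 / 2)"
      unfolding Q_def by (intro epowr_mono carl \<mu>) auto
    also have "\<dots> = ennreal (sqrt D * lnorm S q \<mu>)"
      using D lnorm_nonneg[of S q \<mu>]
      by (simp add: epowr_ennreal powr_half_sqrt real_sqrt_mult)
    also have "\<dots> = ennreal (sqrt D) * epowr L (s / q)"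
      using D by (simp add: ennreal_mult lnorm_nonneg \<mu>L)
    finally show ?thesis .
  qed
  have "enn_Lnorm M (ennreal s) (\<lambda>x. \<integral>\<^sup>+ a. ennreal (cmod (\<nu> a * (R a x * G a x))) \<partial>count_space S)
      \<le> enn_Lnorm M (ennreal s) (\<lambda>x. V x * W x)"
    by (intro enn_Lnorm_mono_AE pos AE_I2 pointwise)
  also have "\<dots> \<le> enn_Lnorm M (ennreal p) V * enn_Lnorm M (ennreal q) W"
    by (intro hoelder pos spq) auto
  also have "\<dots> \<le> (R0 * epowr L (s / p)) * (ennreal (sqrt D) * epowr L (s / q))"
    by (intro mult_mono V W) auto
  also have "\<dots> = R0 * ennreal (sqrt D) * (epowr L (s / p) * epowr L (s / q))"
    by (simp only: ac_simps)
  also have "epowr L (s / p) * epowr L (s / q) = L"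
    by (simp add: s1 flip: epowr_add_exp)
  finally show ?thesis by (simp only: L_def)
qed

section \<open>Limits along nets and operators given by series\<close>

lemma (in hardy_setting) Hardy_closed_filter:
  assumes r: "0 < r" and h: "\<And>i. h i \<in> Hardy A \<sigma> (ennreal r)"
    and f: "f \<in> borel_measurable \<sigma>"
    and lim: "((\<lambda>i. Lnorm \<sigma> (ennreal r) (\<lambda>x. f x - h i x)) \<longlongrightarrow> 0) F" and F: "F \<noteq> bot"
  shows "f \<in> Hardy A \<sigma> (ennreal r)"
proof -
  \<comment> \<open>A nontrivial filter supplies for each \<open>n\<close> one index with error
    below 1 / (n + 1), and this sequence is enough for \<open>Hardy_closed\<close>.\<close>
  have "\<exists>i. Lnorm \<sigma> (ennreal r) (\<lambda>x. f x - h i x) < ennreal (inverse (real (Suc n)))" for n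
    using order_tendstoD(2)[OF lim, of "ennreal (inverse (real (Suc n)))"] F
    by (auto dest: eventually_happens)
  then obtain i where i: "\<And>n. Lnorm \<sigma> (ennreal r) (\<lambda>x. f x - h (i n) x) < ennreal (inverse (real (Suc n)))"
    by metis
  have "(\<lambda>n. ennreal (inverse (real (Suc n)))) \<longlonglongrightarrow> 0"
    using tendsto_ennrealI[OF LIMSEQ_inverse_real_of_nat] by simp
  then have "(\<lambda>n. Lnorm \<sigma> (ennreal r) (\<lambda>x. f x - h (i n) x)) \<longlonglongrightarrow> 0"
    by (rule tendsto_0_ennreal_le) (rule less_imp_le[OF i])
  then show ?thesis by (rule Hardy_closed[OF r h f])
qed

text \<open>The s-th power of a tail norm is the full sum minus a finite partial sum, and this
  difference tends to 0 along the finite subsets of \<open>S\<close>.\<close>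

lemma lnorm_tail_tendsto_0:
  assumes \<nu>: "\<nu> \<in> lspace S s" and s: "0 < s"
  shows "\<And>F. (\<lambda>a. if a \<in> F then 0 else \<nu> a) \<in> lspace S s"
    and "((\<lambda>F. lnorm S s (\<lambda>a. if a \<in> F then 0 else \<nu> a)) \<longlongrightarrow> 0) (finite_subsets_at_top S)"
proof -
  let ?g = "\<lambda>a. cmod (\<nu> a) powr s"
  have sum: "?g summable_on S" using \<nu> by (simp add: lspace_def)
  have eq: "(\<lambda>a. cmod (if a \<in> F then 0 else \<nu> a) powr s) = (\<lambda>a. if a \<in> F then 0 else ?g a)" for F
    by (auto simp: fun_eq_iff)
  have "(\<lambda>a. if a \<in> F then 0 else ?g a) summable_on S \<longleftrightarrow> ?g summable_on (S - F)" for F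
    by (rule summable_on_cong_neutral) auto
  moreover have "?g summable_on (S - F)" for F
    by (rule summable_on_subset_banach[OF sum]) auto
  ultimately show "(\<lambda>a. if a \<in> F then 0 else \<nu> a) \<in> lspace S s" for F
    using \<nu> by (auto simp: lspace_def eq)
  have tail: "lnorm S s (\<lambda>a. if a \<in> F then 0 else \<nu> a) = (infsum ?g S - sum ?g F) powr (1 / s)"
    if F: "finite F" "F \<subseteq> S" for F
  proof -
    have "(\<Sum>\<^sub>\<infinity>a\<in>S. if a \<in> F then 0 else ?g a) = infsum ?g (S - F)"
      by (rule infsum_cong_neutral) auto
    also have "\<dots> = infsum ?g S - sum ?g F"
      using F by (subst infsum_Diff[OF sum]) auto
    finally show ?thesis by (simp add: lnorm_def eq)
  qed
  have le: "sum ?g F \<le> infsum ?g S" if "finite F" "F \<subseteq> S" for F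
    using that by (intro finite_sum_le_infsum sum) auto
  have ev: "\<forall>\<^sub>F F in finite_subsets_at_top S. finite F \<and> F \<subseteq> S"
    by (rule eventually_finite_subsets_at_top_weakI) auto
  have "((\<lambda>F. infsum ?g S - sum ?g F) \<longlongrightarrow> infsum ?g S - infsum ?g S) (finite_subsets_at_top S)"
    by (intro tendsto_diff tendsto_const infsum_tendsto sum)
  then have "((\<lambda>F. (infsum ?g S - sum ?g F) powr (1 / s)) \<longlongrightarrow> 0) (finite_subsets_at_top S)"
    using s ev by (intro tendsto_zero_powrI[OF _ tendsto_const]) (auto elim!: eventually_mono simp: le)
  then show "((\<lambda>F. lnorm S s (\<lambda>a. if a \<in> F then 0 else \<nu> a)) \<longlongrightarrow> 0) (finite_subsets_at_top S)"
    by (rule tendsto_cong[THEN iffD1, rotated]) (use ev in \<open>auto elim!: eventually_mono simp: tail\<close>)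
qed

text \<open>Taking the series pointwise, as an integral over counting measure, makes
  \<open>E\<close> an honest function of \<nu>. The bound on the absolute series gives convergence
  almost everywhere; applied to tails, it gives norm convergence of the partial sums, so membership
  and pairings can be computed on finite sums.\<close>

lemma (in hardy_setting) series_operator:
  fixes F :: "'i \<Rightarrow> 'x \<Rightarrow> complex" and S :: "'i set"
  defines "E \<equiv> \<lambda>\<nu> x. LINT a|count_space S. \<nu> a * F a x"
  assumes cS: "countable S" and s: "1 \<le> s"
    and F: "\<And>a. a \<in> S \<Longrightarrow> F a \<in> Hardy A \<sigma> (ennreal s)"
    and bound: "\<And>\<nu>. \<nu> \<in> lspace S s \<Longrightarrow> enn_Lnorm \<sigma> (ennreal s)
        (\<lambda>x. \<integral>\<^sup>+ a. ennreal (cmod (\<nu> a * F a x)) \<partial>count_space S) \<le> ennreal (B * lnorm S s \<nu>)"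
  shows "bounded_linear_op A \<sigma> s S E"
    and "\<lbrakk>\<nu> \<in> lspace S s; k \<in> Lspace \<sigma> (conj_exp (ennreal s)); b \<in> S;
          \<And>a. a \<in> S \<Longrightarrow> pairing \<sigma> (F a) k = (if a = b then m else 0)\<rbrakk>
        \<Longrightarrow> pairing \<sigma> (E \<nu>) k = \<nu> b * m"
proof -
  have s0: "0 < s" using s by simp
  have Fm [measurable]: "F a \<in> borel_measurable \<sigma>" if "a \<in> S" for a
    by (rule Hardy_measurable[OF F[OF that]])
  have Em [measurable]: "E \<nu> \<in> borel_measurable \<sigma>" for \<nu>
    unfolding E_def by (intro borel_measurable_lebesgue_integral_count_space cS) measurable
  \<comment> \<open>Where the series does not converge absolutely, the integral has the default
    value 0, so the inequality holds at every point.\<close>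
  have le: "ennreal (cmod (E \<nu> x)) \<le> (\<integral>\<^sup>+ a. ennreal (cmod (\<nu> a * F a x)) \<partial>count_space S)" for \<nu> x
  proof (cases "integrable (count_space S) (\<lambda>a. \<nu> a * F a x)")
    case True
    then show ?thesis unfolding E_def by (rule integral_norm_bound_ennreal)
  next
    case False
    then show ?thesis by (simp add: E_def not_integrable_integral_eq)
  qed
  have EB: "Lnorm \<sigma> (ennreal s) (E \<nu>) \<le> ennreal (B * lnorm S s \<nu>)" if "\<nu> \<in> lspace S s" for \<nu>
    unfolding Lnorm_def by (rule order_trans[OF enn_Lnorm_mono_AE[OF s0 AE_I2[OF le]] bound[OF that]])
  have int: "AE x in \<sigma>. integrable (count_space S) (\<lambda>a. \<nu> a * F a x)" if \<nu>: "\<nu> \<in> lspace S s" for \<nu>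
  proof -
    let ?N = "\<lambda>x. \<integral>\<^sup>+ a. ennreal (cmod (\<nu> a * F a x)) \<partial>count_space S"
    have [measurable]: "?N \<in> borel_measurable \<sigma>"
      by (intro borel_measurable_nn_integral_count_space cS) measurable
    have "enn_Lnorm \<sigma> (ennreal s) ?N < \<top>"
      by (rule order_le_less_trans[OF bound[OF \<nu>]]) simp
    then have "(\<integral>\<^sup>+ x. epowr (?N x) s \<partial>\<sigma>) \<noteq> \<infinity>"
      using s0 by (simp add: enn_Lnorm_finite less_top)
    then have "AE x in \<sigma>. epowr (?N x) s \<noteq> \<infinity>"
      by (intro nn_integral_noteq_infinite) measurable
    then show ?thesis
      by (auto elim!: eventually_mono intro!: integrableI_bounded simp: less_top)
  qed
  \<comment> \<open>Intersecting with \<open>S\<close> keeps the partial sum in the Hardy space for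
    every \<open>T\<close>, as \<open>Hardy_closed_filter\<close> asks.\<close>
  define P where "P \<nu> T = (\<lambda>x. \<Sum>a\<in>T \<inter> S. \<nu> a * F a x)" for \<nu> :: "'i \<Rightarrow> complex" and T
  have PH: "P \<nu> T \<in> Hardy A \<sigma> (ennreal s)" for \<nu> T
    unfolding P_def by (intro Hardy_sum[OF s0] Hardy_cmult[OF s0] F) auto
  have tail: "Lnorm \<sigma> (ennreal s) (\<lambda>x. E \<nu> x - P \<nu> T x)
      \<le> ennreal (B * lnorm S s (\<lambda>a. if a \<in> T then 0 else \<nu> a))" if T: "finite T" and \<nu>: "\<nu> \<in> lspace S s" for T \<nu>
  proof -
    \<comment> \<open>Subtracting the partial sum removes exactly the terms in \<open>T\<close>: the
      error is \<open>E\<close> of the truncated sequence, to which the bound applies.\<close>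
    have "AE x in \<sigma>. E \<nu> x - P \<nu> T x = E (\<lambda>a. if a \<in> T then 0 else \<nu> a) x"
      using int[OF \<nu>]
    proof eventually_elim
      case (elim x)
      let ?f = "\<lambda>a. \<nu> a * F a x * indicator T a"
      have fin: "finite {a \<in> S. ?f a \<noteq> 0}"
        by (rule finite_subset[OF _ T]) (auto simp: indicator_def)
      have i: "integrable (count_space S) ?f"
        unfolding integrable_iff_bounded
        using fin by (subst nn_integral_count_space) (auto simp: less_le conj_commute cong: conj_cong)
      have "(\<lambda>a. (if a \<in> T then 0 else \<nu> a) * F a x) = (\<lambda>a. \<nu> a * F a x - ?f a)"
        by (auto simp: indicator_def)
      then have "E (\<lambda>a. if a \<in> T then 0 else \<nu> a) x = E \<nu> x - (LINT a|count_space S. ?f a)"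
        unfolding E_def using elim i by simp
      also have "(LINT a|count_space S. ?f a) = (\<Sum>a | a \<in> S \<and> ?f a \<noteq> 0. ?f a)"
        using fin by (rule lebesgue_integral_count_space_finite_support)
      also have "\<dots> = (\<Sum>a\<in>T \<inter> S. ?f a)"
        using T by (intro sum.mono_neutral_left) (auto simp: indicator_def)
      also have "\<dots> = P \<nu> T x"
        unfolding P_def by (intro sum.cong) auto
      finally show ?case by simp
    qed
    then have "Lnorm \<sigma> (ennreal s) (\<lambda>x. E \<nu> x - P \<nu> T x) = Lnorm \<sigma> (ennreal s) (E (\<lambda>a. if a \<in> T then 0 else \<nu> a))"
      by (rule Lnorm_cong_AE[OF s0])
    then show ?thesis using EB[OF lnorm_tail_tendsto_0(1)[OF \<nu> s0]] by simp
  qed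
  have lim: "((\<lambda>T. Lnorm \<sigma> (ennreal s) (\<lambda>x. E \<nu> x - P \<nu> T x)) \<longlongrightarrow> 0) (finite_subsets_at_top S)"
    if \<nu>: "\<nu> \<in> lspace S s" for \<nu>
  proof (rule tendsto_sandwich[OF always_eventually _ tendsto_const])
    show "\<forall>\<^sub>F T in finite_subsets_at_top S. Lnorm \<sigma> (ennreal s) (\<lambda>x. E \<nu> x - P \<nu> T x)
        \<le> ennreal (B * lnorm S s (\<lambda>a. if a \<in> T then 0 else \<nu> a))"
      by (rule eventually_finite_subsets_at_top_weakI) (rule tail[OF _ \<nu>])
    show "((\<lambda>T. ennreal (B * lnorm S s (\<lambda>a. if a \<in> T then 0 else \<nu> a))) \<longlongrightarrow> 0) (finite_subsets_at_top S)"
      using tendsto_ennrealI[OF tendsto_mult_right_zero[OF lnorm_tail_tendsto_0(2)[OF \<nu> s0]], of B] by simp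
  qed auto
  have EH: "E \<nu> \<in> Hardy A \<sigma> (ennreal s)" if "\<nu> \<in> lspace S s" for \<nu>
    by (rule Hardy_closed_filter[OF s0 PH Em lim[OF that]]) simp
  show "bounded_linear_op A \<sigma> s S E"
    unfolding bounded_linear_op_def
  proof (intro conjI ballI allI)
    fix \<nu> assume \<nu>: "\<nu> \<in> lspace S s"
    show "E \<nu> \<in> Hardy A \<sigma> (ennreal s)" by (rule EH[OF \<nu>])
    show "AE x in \<sigma>. E (\<lambda>a. \<nu> a + \<mu> a) x = E \<nu> x + E \<mu> x" if \<mu>: "\<mu> \<in> lspace S s" for \<mu>
      using int[OF \<nu>] int[OF \<mu>] by eventually_elim (simp add: E_def ring_distribs)
    show "AE x in \<sigma>. E (\<lambda>a. c * \<nu> a) x = c * E \<nu> x" for c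
      by (simp add: E_def mult.assoc)
  next
    show "\<exists>C. \<forall>\<nu>\<in>lspace S s. Lnorm \<sigma> (ennreal s) (E \<nu>) \<le> ennreal (C * lnorm S s \<nu>)"
      using EB by blast
  qed
  assume \<nu>: "\<nu> \<in> lspace S s" and k: "k \<in> Lspace \<sigma> (conj_exp (ennreal s))" and b: "b \<in> S"
    and pk: "\<And>a. a \<in> S \<Longrightarrow> pairing \<sigma> (F a) k = (if a = b then m else 0)"
  have sum_pairing: "pairing \<sigma> (P \<nu> T) k = (\<Sum>a\<in>T \<inter> S. \<nu> a * pairing \<sigma> (F a) k)" for T
  proof -
    have "integrable \<sigma> (\<lambda>x. \<nu> a * (F a x * cnj (k x)))" if "a \<in> T \<inter> S" for a
      using that by (intro integrable_mult_right pairing_integrable_bound(1)[OF s _ k] Hardy_Lspace F) auto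
    then show ?thesis
      by (simp add: pairing_def P_def sum_distrib_right mult.assoc)
  qed
  \<comment> \<open>Once \<open>T\<close> contains \<open>b\<close>, the other terms vanish and the
    pairing has its final value, so the net of pairings is eventually constant.\<close>
  have "pairing \<sigma> (P \<nu> T) k = \<nu> b * m" if "finite T" "b \<in> T" for T
  proof -
    have "pairing \<sigma> (P \<nu> T) k = (\<Sum>a\<in>T \<inter> S. if a = b then \<nu> b * m else 0)"
      unfolding sum_pairing using pk by (intro sum.cong) auto
    then show ?thesis using that b by simp
  qed
  then have "\<forall>\<^sub>F T in finite_subsets_at_top S. pairing \<sigma> (P \<nu> T) k = \<nu> b * m"
    unfolding eventually_finite_subsets_at_top using b by (intro exI[of _ "{b}"]) auto
  then have "((\<lambda>T. pairing \<sigma> (P \<nu> T) k) \<longlongrightarrow> \<nu> b * m) (finite_subsets_at_top S)"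
    by (rule tendsto_eventually)
  moreover have "((\<lambda>T. pairing \<sigma> (P \<nu> T) k) \<longlongrightarrow> pairing \<sigma> (E \<nu>) k) (finite_subsets_at_top S)"
    by (rule pairing_tendsto[OF s Hardy_Lspace[OF PH] Hardy_Lspace[OF EH[OF \<nu>]] k lim[OF \<nu>]])
  ultimately show "pairing \<sigma> (E \<nu>) k = \<nu> b * m"
    using tendsto_unique[OF finite_subsets_at_top_neq_bot] by blast
qed

section \<open>Kernel norms and the weights of the extension operator\<close>

lemma (in hardy_setting) kernel_norm:
  assumes a: "a \<in> gelfand_spectrum A" "\<And>f. f \<in> A \<Longrightarrow> a f = pairing \<sigma> f k"
    and t: "1 \<le> t" and k: "k \<in> Lspace \<sigma> t"
  shows "Lnorm \<sigma> t k = ennreal (enn2real (Lnorm \<sigma> t k))" "0 < enn2real (Lnorm \<sigma> t k)"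
proof -
  have top: "Lnorm \<sigma> t k < \<top>" using k by (simp add: Lspace_def)
  then show "Lnorm \<sigma> t k = ennreal (enn2real (Lnorm \<sigma> t k))" by simp
  have [measurable]: "k \<in> borel_measurable \<sigma>" by (rule Lspace_measurable[OF k])
  \<comment> \<open>A kernel that is 0 almost everywhere would send the constant 1 to 0, but a point
    of the spectrum sends it to 1.\<close>
  have "Lnorm \<sigma> t k \<noteq> 0"
  proof
    assume 0: "Lnorm \<sigma> t k = 0"
    have "Lnorm \<sigma> (ennreal 1) k \<le> Lnorm \<sigma> t k"
    proof (cases t)
      case (real u)
      then show ?thesis using t Lnorm_le_exponent[of 1 u k] by simp
    next
      case top
      then show ?thesis using Lnorm_le_top[of 1 k] by simp
    qed
    then have "AE x in \<sigma>. k x = 0"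
      using 0 by (intro Lnorm_eq_0[of 1]) auto
    then have "pairing \<sigma> (\<lambda>x. 1) k = (LINT x|\<sigma>. 0)"
      unfolding pairing_def by (intro integral_cong_AE) (auto elim!: eventually_mono)
    then show False
      using gelfand_spectrum_one[OF a(1)] a(2)[OF A_one] by simp
  qed
  then show "0 < enn2real (Lnorm \<sigma> t k)"
    using top by (simp add: enn2real_positive_iff zero_less_iff_neq_zero)
qed

text \<open>The hypothesis with \<beta> bounds \<open>N s'\<close> by \<beta> N p' N q'. After
  multiplication by \<open>N q\<close>, the hypothesis with \<alpha> absorbs the product of
  \<open>N q\<close> and \<open>N q'\<close> into (N 2)^2 / \<alpha>, leaving \<beta> /
  \<alpha>.\<close>

lemma interpolation_weight_le:
  fixes \<sigma> :: "'x measure" and k :: "'x \<Rightarrow> complex" and p' q q' s' :: ennreal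
  defines "N \<equiv> \<lambda>t. enn2real (Lnorm \<sigma> t k)"
  assumes fin: "\<And>t. t \<in> {s', p', q', q, 2} \<Longrightarrow> Lnorm \<sigma> t k = ennreal (N t) \<and> 0 < N t"
    and \<alpha>: "0 < \<alpha>" "(Lnorm \<sigma> 2 k)\<^sup>2 \<ge> ennreal \<alpha> * Lnorm \<sigma> q k * Lnorm \<sigma> q' k"
    and \<beta>: "0 < \<beta>" "Lnorm \<sigma> s' k \<le> ennreal \<beta> * Lnorm \<sigma> p' k * Lnorm \<sigma> q' k"
  shows "N s' * N q / (N p' * (N 2)\<^sup>2) \<le> \<beta> / \<alpha>"
proof -
  have L: "Lnorm \<sigma> s' k = ennreal (N s')" "Lnorm \<sigma> p' k = ennreal (N p')" "Lnorm \<sigma> q' k = ennreal (N q')"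
    "Lnorm \<sigma> q k = ennreal (N q)" "Lnorm \<sigma> 2 k = ennreal (N 2)"
    and pos: "0 < N s'" "0 < N p'" "0 < N q'" "0 < N q" "0 < N 2"
    using fin by blast+
  have 1: "\<alpha> * N q * N q' \<le> (N 2)\<^sup>2"
    using \<alpha> pos unfolding L by (simp add: ennreal_power flip: ennreal_mult)
  have 2: "N s' \<le> \<beta> * N p' * N q'"
    using \<beta> pos unfolding L by (simp flip: ennreal_mult)
  have "N s' * N q * \<alpha> \<le> (\<beta> * N p' * N q') * N q * \<alpha>"
    using 2 pos \<alpha>(1) by (intro mult_right_mono) auto
  also have "\<dots> = \<beta> * N p' * (\<alpha> * N q * N q')" by (simp only: ac_simps)
  also have "\<dots> \<le> \<beta> * N p' * (N 2)\<^sup>2"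
    using 1 pos \<beta>(1) by (intro mult_left_mono) auto
  finally show ?thesis
    using pos \<alpha>(1) by (simp add: field_simps)
qed

theorem theorem5p1:
  fixes A :: "('x::topological_space \<Rightarrow> complex) set"
    and \<sigma> :: "'x measure"
    and p s q :: real
    and S :: "(('x \<Rightarrow> complex) \<Rightarrow> complex) set"
  assumes "compact (UNIV :: 'x set)"
    and "uniform_algebra A"
    and "prob_space \<sigma>" and "sets \<sigma> = sets borel"
    and "1 \<le> p" and "p \<le> 2" and "1 \<le> s" and "s < p"
    and "1 / s = 1 / p + 1 / q"
    and "countable S"
    and "S \<subseteq> spectrum A \<sigma> (ennreal s) \<inter> spectrum A \<sigma> (conj_exp (ennreal q))"
    and "dual_bounded A \<sigma> (ennreal p) S"
    and "weakly_Carleson A \<sigma> q S"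
    and "SH_q A \<sigma> (ennreal q)"
    and "SH_ps A \<sigma> (ennreal p) (ennreal s) (ennreal q)"
  shows "interpolating A \<sigma> s S \<and> linear_extension_property A \<sigma> s S"
proof -
  interpret hardy_setting \<sigma> A
    using assms(1-4) by (intro hardy_setting.intro hardy_setting_axioms.intro) auto
  note s = \<open>1 \<le> s\<close> and spq = \<open>1 / s = 1 / p + 1 / q\<close> and cS = \<open>countable S\<close>
  have p1: "1 < p" using assms(7,8) by simp
  have s0: "0 < s" "0 < p" using assms(7,8) by auto
  \<comment> \<open>This difference is positive and at most 1 - 1 / 2, whence
    \<open>2 \<le> q\<close>; positivity also excludes \<open>q = 0\<close>, where
    \<open>1 / q\<close> would be 0.\<close>
  have "1 / q = 1 / s - 1 / p" using spq by simp
  moreover have "1 / s \<le> 1" "1 / 2 \<le> 1 / p" "1 / p < 1 / s"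
    using assms(5-8) by (auto simp: field_simps)
  ultimately have "0 < 1 / q" "1 / q \<le> 1 / 2" by auto
  then have q2: "2 \<le> q" by (auto simp: field_simps split: if_splits)
  then have q0: "0 < q" and q1: "1 < q" by auto
  define s' where "s' = conj_exp (ennreal s)"
  define p' where "p' = conj_exp (ennreal p)"
  define q' where "q' = conj_exp (ennreal q)"
  define K where "K = kernel A \<sigma>"
  define N where "N t a = enn2real (Lnorm \<sigma> t (K a))" for t a
  have p': "p' = ennreal (p / (p - 1))" and q': "q' = ennreal (q / (q - 1))"
    unfolding p'_def q'_def using p1 q1 by (simp_all only: conj_exp_finite)
  have q'le: "q / (q - 1) \<le> 2" "q / (q - 1) \<le> q" "1 \<le> q / (q - 1)"
    using q2 by (auto simp: field_simps)
  have p'1: "1 \<le> p / (p - 1)" using p1 by (simp add: field_simps)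
  \<comment> \<open>Conjugation reverses \<open>s < p\<close>, so kernels known at the exponent
    \<open>s'\<close> also have finite p'-norm. For \<open>s = 1\<close> the exponent
    \<open>s'\<close> is infinite.\<close>
  have p's': "ennreal (p / (p - 1)) \<le> s'"
  proof (cases "s = 1")
    case True
    then show ?thesis using conj_exp_1 by (simp add: s'_def)
  next
    case False
    then have "1 < s" using s by simp
    moreover from this have "p / (p - 1) \<le> s / (s - 1)" using assms(8) by (simp add: field_simps)
    ultimately show ?thesis by (simp add: s'_def conj_exp_finite ennreal_leI)
  qed
  have spec: "a \<in> spectrum A \<sigma> (ennreal s)" "a \<in> spectrum A \<sigma> q'" "a \<in> gelfand_spectrum A" if "a \<in> S" for a
    using that assms(11) by (auto simp: q'_def spectrum_def)
  have rep: "f \<in> A \<Longrightarrow> a f = pairing \<sigma> f (K a)" if "a \<in> S" for a f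
    unfolding K_def using kernel_spec(1)[OF q2 spec(2)[OF that, unfolded q'_def]] by blast
  have Kq: "K a \<in> Hardy A \<sigma> (ennreal q)" and Ks: "K a \<in> Hardy A \<sigma> s'" if "a \<in> S" for a
    using kernel_spec(2)[OF q2 spec(2)[OF that, unfolded q'_def], of q'] spec(2)[OF that]
      kernel_spec(2)[OF q2 spec(2)[OF that, unfolded q'_def], of "ennreal s"] spec(1)[OF that] s
      conj_exp_ge_1[of "ennreal q"]
    by (auto simp: K_def q'_def s'_def conj_exp_conj_exp[OF q1])
  \<comment> \<open>SH(q) concerns points of both spectra. Since \<open>q' \<le> q\<close>, the
    kernel in the q-Hardy space also lies in the q'-Hardy space, which places the point in the
    q-spectrum.\<close>
  have specq: "a \<in> spectrum A \<sigma> (ennreal q)" if "a \<in> S" for a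
    using Hardy_antimono[of "q / (q - 1)" q "K a"] Kq[OF that] q'le rep[OF that] spec(3)[OF that] q'
    by (auto simp: spectrum_def q'_def)
  \<comment> \<open>Membership for \<open>s'\<close> and \<open>q\<close> comes from the two
    spectra; \<open>p'\<close> lies below \<open>s'\<close>, and \<open>q'\<close> and 2 lie below
    \<open>q\<close>.\<close>
  have KL: "K a \<in> Lspace \<sigma> t" if "a \<in> S" "t \<in> {s', p', q', ennreal q, 2}" for a t
  proof -
    have q: "K a \<in> Lspace \<sigma> (ennreal q)" by (rule Hardy_Lspace[OF Kq[OF that(1)]])
    have s: "K a \<in> Lspace \<sigma> s'" by (rule Hardy_Lspace[OF Ks[OF that(1)]])
    have "K a \<in> Lspace \<sigma> p'" unfolding p' by (rule Lspace_antimono[OF _ p's' s]) (use p'1 in auto)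
    moreover have "K a \<in> Lspace \<sigma> q'" unfolding q' by (rule Lspace_antimono[OF _ _ q]) (use q'le q0 in \<open>auto intro: ennreal_leI\<close>)
    moreover have "K a \<in> Lspace \<sigma> (ennreal 2)" by (rule Lspace_antimono[OF _ _ q]) (use q2 in \<open>auto intro!: ennreal_leI simp del: ennreal_numeral\<close>)
    ultimately show ?thesis using that(2) q s by auto
  qed
  have ge1: "1 \<le> t" if "t \<in> {s', p', q', ennreal q, 2}" for t
    using that q1 conj_exp_ge_1 by (auto simp: s'_def p'_def q'_def)
  have N: "Lnorm \<sigma> t (K a) = ennreal (N t a)" "0 < N t a"
    if "a \<in> S" "t \<in> {s', p', q', ennreal q, 2}" for a t
    unfolding N_def using kernel_norm[OF spec(3)[OF that(1)] rep[OF that(1)] ge1[OF that(2)] KL[OF that]] by auto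
  \<comment> \<open>At \<open>a\<close>, the dual function has the value \<open>N p' a\<close> and
    the q-normalized kernel the value (N 2 a)^2 / N q a; \<open>c a\<close> rescales their product
    to the prescribed \<open>N s' a\<close>.\<close>
  define c where "c a = N s' a * N (ennreal q) a / (N p' a * (N 2 a)\<^sup>2)" for a
  obtain \<alpha> where \<alpha>: "0 < \<alpha>" "\<And>a. a \<in> S \<Longrightarrow> (Lnorm \<sigma> 2 (K a))\<^sup>2 \<ge>
      ennreal \<alpha> * Lnorm \<sigma> (ennreal q) (K a) * Lnorm \<sigma> q' (K a)"
    using assms(14) specq spec(2) unfolding SH_q_def K_def q'_def by blast
  obtain \<beta> where \<beta>: "0 < \<beta>" "\<And>a. a \<in> S \<Longrightarrow> Lnorm \<sigma> s' (K a) \<le>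
      ennreal \<beta> * Lnorm \<sigma> p' (K a) * Lnorm \<sigma> q' (K a)"
    using assms(15) spec(1) unfolding SH_ps_def K_def q'_def p'_def s'_def by blast
  have c: "0 \<le> c a" "c a \<le> \<beta> / \<alpha>" if "a \<in> S" for a
  proof -
    show "0 \<le> c a" by (simp add: c_def N_def)
    show "c a \<le> \<beta> / \<alpha>"
      unfolding c_def N_def
      using N[OF that] \<alpha>(2)[OF that] \<beta>(2)[OF that] \<alpha>(1) \<beta>(1) unfolding N_def
      by (intro interpolation_weight_le[where q'=q']) auto
  qed
  obtain \<rho> where \<rho>: "\<And>a. a \<in> S \<Longrightarrow> \<rho> a \<in> Hardy A \<sigma> (ennreal p)"
    and \<rho>b: "(SUP a\<in>S. Lnorm \<sigma> (ennreal p) (\<rho> a)) < \<infinity>"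
    and dual: "\<And>a b. a \<in> S \<Longrightarrow> b \<in> S \<Longrightarrow> pairing \<sigma> (\<rho> a) (nkernel A \<sigma> p' b) = (if a = b then 1 else 0)"
    using assms(12) unfolding dual_bounded_def p'_def by blast
  define M where "M = enn2real (SUP a\<in>S. Lnorm \<sigma> (ennreal p) (\<rho> a))"
  have M: "(SUP a\<in>S. Lnorm \<sigma> (ennreal p) (\<rho> a)) = ennreal M" "0 \<le> M"
    using \<rho>b by (simp_all add: M_def)
  have nk: "nkernel A \<sigma> t a = (\<lambda>x. complex_of_real (1 / N t a) * K a x)" for t a
    by (simp add: nkernel_def N_def K_def fun_eq_iff)
  define G where "G = nkernel A \<sigma> (ennreal q)"
  have G: "G a \<in> Hardy A \<sigma> (ennreal q)" if "a \<in> S" for a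
    unfolding G_def nk by (rule Hardy_cmult[OF q0 Kq[OF that]])
  \<comment> \<open>The weight goes into the dual system, whose norms stay uniformly bounded because
    the weights do.\<close>
  define R where "R a = (\<lambda>x. complex_of_real (c a) * \<rho> a x)" for a
  have R: "R a \<in> Hardy A \<sigma> (ennreal p)" if "a \<in> S" for a
    unfolding R_def by (rule Hardy_cmult[OF s0(2) \<rho>[OF that]])
  have Rb: "Lnorm \<sigma> (ennreal p) (R a) \<le> ennreal (\<beta> / \<alpha>) * ennreal M" if "a \<in> S" for a
  proof -
    have "Lnorm \<sigma> (ennreal p) (R a) = ennreal (c a) * Lnorm \<sigma> (ennreal p) (\<rho> a)"
      unfolding R_def using c(1)[OF that] by (simp add: Lnorm_cmult[OF s0(2) Hardy_measurable[OF \<rho>[OF that]]])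
    also have "\<dots> \<le> ennreal (\<beta> / \<alpha>) * ennreal M"
      unfolding M(1)[symmetric] using c(2)[OF that] that by (intro mult_mono ennreal_leI SUP_upper) auto
    finally show ?thesis .
  qed
  obtain D where D: "0 < D" and carl: "\<And>\<mu>. \<mu> \<in> lspace S q \<Longrightarrow> enn_Lnorm \<sigma> (ennreal (q / 2))
          (\<lambda>x. \<Sum>\<^sub>\<infinity>a\<in>S. ennreal ((cmod (\<mu> a))\<^sup>2 * (cmod (G a x))\<^sup>2)) \<le> ennreal (D * (lnorm S q \<mu>)\<^sup>2)"
    using assms(13) unfolding weakly_Carleson_def G_def by blast
  define F where "F a = (\<lambda>x. R a x * G a x)" for a
  have F: "F a \<in> Hardy A \<sigma> (ennreal s)" if "a \<in> S" for a
    unfolding F_def using Hardy_mult[OF s0 q0 spq R[OF that] G[OF that]] by blast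
  define B where "B = \<beta> / \<alpha> * M * sqrt D"
  have bound: "enn_Lnorm \<sigma> (ennreal s) (\<lambda>x. \<integral>\<^sup>+ a. ennreal (cmod (\<nu> a * F a x)) \<partial>count_space S)
      \<le> ennreal (B * lnorm S s \<nu>)" if "\<nu> \<in> lspace S s" for \<nu>
  proof -
    have "enn_Lnorm \<sigma> (ennreal s) (\<lambda>x. \<integral>\<^sup>+ a. ennreal (cmod (\<nu> a * F a x)) \<partial>count_space S)
        \<le> ennreal (\<beta> / \<alpha>) * ennreal M * ennreal (sqrt D) * ennreal (lnorm S s \<nu>)"
      unfolding F_def using D
      by (intro Lnorm_weighted_sum_le[OF cS s0 assms(6) q0 spq _ _ Rb _ carl that])
        (auto intro: Hardy_measurable R G)
    also have "\<dots> = ennreal (B * lnorm S s \<nu>)"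
      using \<alpha>(1) \<beta>(1) M(2) D lnorm_nonneg[of S s \<nu>] by (simp add: B_def flip: ennreal_mult)
    finally show ?thesis .
  qed
  \<comment> \<open>Undoes the normalization of the kernels in the p'-norm.\<close>
  have \<rho>K: "pairing \<sigma> (\<rho> a) (K b) = (if a = b then complex_of_real (N p' b) else 0)" if "a \<in> S" "b \<in> S" for a b
  proof -
    have "complex_of_real (1 / N p' b) * pairing \<sigma> (\<rho> a) (K b) = (if a = b then 1 else 0)"
      using dual[OF that] unfolding nk pairing_cmult_right by simp
    then show ?thesis using N(2)[OF that(2), of p'] by (auto simp: field_simps split: if_splits)
  qed
  \<comment> \<open>\<open>Hval_mult\<close> splits the pairing at \<open>b\<close>. Off the
    diagonal the dual function contributes 0; on it the weight \<open>c a\<close> cancels the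
    normalizations.\<close>
  have FK: "pairing \<sigma> (F a) (K b) = (if a = b then complex_of_real (N s' b) else 0)" if "a \<in> S" "b \<in> S" for a b
  proof -
    have "pairing \<sigma> (F a) (K b) = pairing \<sigma> (R a) (K b) * pairing \<sigma> (G a) (K b)"
      unfolding F_def
      using Hval_mult[OF s s0(2) q0 spq R[OF that(1)] G[OF that(1)] spec(3)[OF that(2)] rep[OF that(2)]]
        KL[OF that(2), of s'] by (simp add: s'_def)
    also have "\<dots> = complex_of_real (c a) * (if a = b then complex_of_real (N p' b) else 0) *
        (complex_of_real (1 / N (ennreal q) a) * pairing \<sigma> (K a) (K b))"
      by (simp add: R_def G_def nk pairing_cmult \<rho>K[OF that] del: of_real_divide)
    also have "\<dots> = (if a = b then complex_of_real (N s' b) else 0)"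
    proof (cases "a = b")
      case True
      have "ennreal ((N 2 a)\<^sup>2) = ennreal (Re (pairing \<sigma> (K a) (K a)))"
        using Lnorm_2_sq_eq_pairing(1)[OF KL[OF that(1), of 2]] N[OF that(1), of 2]
        by (simp add: ennreal_power)
      \<comment> \<open>\<open>ennreal\<close> sends negative reals to 0, so the equality of reals
        is recovered from the positivity of \<open>N 2 a\<close>.\<close>
      then have "Re (pairing \<sigma> (K a) (K a)) = (N 2 a)\<^sup>2"
        using N(2)[OF that(1), of 2]
        by (metis ennreal_inj ennreal_neg ennreal_eq_0_iff insertCI linorder_not_le not_less_iff_gr_or_eq
            zero_less_power nle_le)
      then have "pairing \<sigma> (K a) (K a) = complex_of_real ((N 2 a)\<^sup>2)"
        using Lnorm_2_sq_eq_pairing(2)[OF KL[OF that(1), of 2]] by (simp add: complex_eq_iff)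
      moreover have "c a * N p' a * (1 / N (ennreal q) a * (N 2 a)\<^sup>2) = N s' a"
        using N(2)[OF that(1)] by (simp add: c_def field_simps less_imp_neq[THEN not_sym])
      ultimately show ?thesis using True by (simp flip: of_real_mult of_real_power of_real_divide)
    qed simp
    finally show ?thesis .
  qed
  define E where "E \<nu> x = (LINT a|count_space S. \<nu> a * F a x)" for \<nu> x
  have E: "bounded_linear_op A \<sigma> s S E"
    unfolding E_def[abs_def] by (rule series_operator(1)[OF cS s F bound])
  have val: "Hval A \<sigma> (E \<nu>) b = \<nu> b * complex_of_real (enn2real (Lnorm \<sigma> (conj_exp (ennreal s)) (kernel A \<sigma> b)))"
    if "\<nu> \<in> lspace S s" "b \<in> S" for \<nu> b
    using series_operator(2)[OF cS s F bound that(1) _ that(2), of "K b" "complex_of_real (N s' b)"]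
      KL[OF that(2), of s'] FK[OF _ that(2)]
    by (simp add: Hval_def E_def[abs_def] N_def K_def s'_def)
  have "interpolating A \<sigma> s S"
    unfolding interpolating_def
  proof (intro conjI ballI)
    show "S \<subseteq> spectrum A \<sigma> (ennreal s)" using assms(11) by blast
    fix \<nu> assume "\<nu> \<in> lspace S s"
    then show "\<exists>f\<in>Hardy A \<sigma> (ennreal s). \<forall>a\<in>S. Hval A \<sigma> f a = \<nu> a *
          complex_of_real (enn2real (Lnorm \<sigma> (conj_exp (ennreal s)) (kernel A \<sigma> a)))"
      using E val by (intro bexI[of _ "E \<nu>"]) (auto simp: bounded_linear_op_def)
  qed
  moreover have "linear_extension_property A \<sigma> s S"
    unfolding linear_extension_property_def using E val by blast
  ultimately show ?thesis ..
qed

end
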